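(* Let $\alpha\in(0,1)$, and let $\rho_{ABE}=|\psi\rangle\langle\psi|_{ABE}$ be a pure state on $\mathbb{C}_A\otimes\mathbb{C}_B\otimes\mathbb{C}_E$, with reduced states $\rho_{AE}=\mathrm{Tr}_B(\rho_{ABE})$, $\rho_{AB}=\mathrm{Tr}_E(\rho_{ABE})$ and $\rho_A=\mathrm{Tr}_{BE}(\rho_{ABE})$. Then $$C_{\alpha}(\rho_{AE})=\sup_{\xi_{AE}^{\mathcal{M}_E}}Q_{\alpha}(\xi_{AE}^{\mathcal{M}_E})=S_{\alpha}(\rho_A)-E_f^{\alpha}(\rho_{AB}),$$ where the supremum runs over all ensembles $\xi_{AE}^{\mathcal{M}_E}$ on $A$ created by POVMs $\mathcal{M}_E$ on $E$.
   Context: All Hilbert spaces $\mathbb{C}_A,\mathbb{C}_B,\mathbb{C}_E$ are finite-dimensional complex Hilbert spaces. A state is a positive semidefinite operator of trace one. Quantum $\alpha$-Rényi entropy: $S_\alpha(\rho)=\frac{1}{1-\alpha}\log\mathrm{Tr}(\rho^\alpha)$. $\alpha$-quantum Jensen-Shannon divergence of an ensemble $\xi=\{p_k,\rho_k\}_k$ of states: $Q_\alpha(\xi)=S_\alpha\big(\sum_k p_k\rho_k\big)-\sum_k p_kS_\alpha(\rho_k)$. For a bipartite state $\rho_{AE}$ and a POVM $\mathcal{M}_E=\{M_x\}_x$ on $E$ (finitely many positive semidefinite operators summing to the identity), the ensemble created on $A$ is $\xi_{AE}^{\mathcal{M}_E}=\{p_x,\rho_x^A\}_x$, where $p_x\rho_x^A=\mathrm{Tr}_E\big((\mathbb{I}_A\otimes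 M_x)\rho_{AE}\big)$ and $p_x$ is the trace of this operator (terms with $p_x=0$ are dropped). Define $C_\alpha(\rho_{AE})=\sup_{\mathcal{M}_E}Q_\alpha(\xi_{AE}^{\mathcal{M}_E})$, the supremum being over all POVMs on $E$ (the measurement is on the second-named subsystem). $\alpha$-entanglement of formation of a bipartite state: $E_f^\alpha(\rho_{AB})=\inf\sum_i p_iS_\alpha\big(\mathrm{Tr}_B|\psi_i\rangle\langle\psi_i|\big)$, the infimum being over all finite pure-state ensembles $\{p_i,|\psi_i\rangle\langle\psi_i|\}_i$ with $\rho_{AB}=\sum_ip_i|\psi_i\rangle\langle\psi_i|$. *)

theory Defs
  imports "HOL-Analysis.Analysis"
begin

text \<open>
  A finite-dimensional Hilbert space with orthonormal basis indexed by the finite type \<open>'n\<close> is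
  \<open>complex^'n\<close>, its operators are the matrices \<open>complex^'n^'n\<close>, and the tensor product of
  the spaces indexed by \<open>'a\<close> and \<open>'b\<close> is the space indexed by \<open>'a \<times> 'b\<close>.
\<close>

definition cinner :: "complex^'n \<Rightarrow> complex^'n \<Rightarrow> complex" where
  "cinner v w = (\<Sum>i\<in>UNIV. cnj (v $ i) * w $ i)"

definition dagger :: "complex^'n^'n \<Rightarrow> complex^'n^'n" where
  "dagger A = (\<chi> i j. cnj (A $ j $ i))"

definition unitary :: "complex^'n^'n \<Rightarrow> bool" where
  "unitary U \<longleftrightarrow> dagger U ** U = mat 1 \<and> U ** dagger U = mat 1"

definition psd :: "complex^'n^'n \<Rightarrow> bool" where
  "psd A \<longleftrightarrow> dagger A = A \<and> (\<forall>v. 0 \<le> Re (cinner v (A *v v)))"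

definition ketbra :: "complex^'n \<Rightarrow> complex^'n^'n" where
  "ketbra v = (\<chi> i j. v $ i * cnj (v $ j))"

definition real_diag :: "('n \<Rightarrow> real) \<Rightarrow> complex^'n^'n" where
  "real_diag d = (\<chi> i j. if i = j then complex_of_real (d i) else 0)"

definition tensor :: "complex^('a::finite)^'a \<Rightarrow> complex^('b::finite)^'b \<Rightarrow> complex^('a \<times> 'b)^('a \<times> 'b)" where
  "tensor A B = (\<chi> i j. A $ fst i $ fst j * B $ snd i $ snd j)"

definition ptrace_snd :: "complex^('a::finite \<times> 'b::finite)^('a \<times> 'b) \<Rightarrow> complex^'a^'a" where
  "ptrace_snd R = (\<chi> i j. \<Sum>k\<in>UNIV. R $ (i, k) $ (j, k))"

text \<open>
  On \<open>A \<otimes> B \<otimes> E\<close>, indexed by \<open>'a \<times> ('b \<times> 'e)\<close>, the trace over \<open>B \<otimes> E\<close> is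
  \<open>ptrace_snd\<close>; the following are the traces over \<open>B\<close> and over \<open>E\<close>.
\<close>

definition ptrace_B ::
  "complex^('a::finite \<times> 'b::finite \<times> 'e::finite)^('a \<times> 'b \<times> 'e) \<Rightarrow> complex^('a \<times> 'e)^('a \<times> 'e)" where
  "ptrace_B R = (\<chi> i j. \<Sum>b\<in>UNIV. R $ (fst i, b, snd i) $ (fst j, b, snd j))"

definition ptrace_E ::
  "complex^('a::finite \<times> 'b::finite \<times> 'e::finite)^('a \<times> 'b \<times> 'e) \<Rightarrow> complex^('a \<times> 'b)^('a \<times> 'b)" where
  "ptrace_E R = (\<chi> i j. \<Sum>e\<in>UNIV. R $ (fst i, snd i, e) $ (fst j, snd j, e))"

text \<open>
  Power of a positive semidefinite matrix by spectral calculus. The result does not depend on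
  the chosen spectral decomposition. As \<open>0 powr \<alpha> = 0\<close>, zero eigenvalues are mapped to zero.
\<close>

definition psd_powr :: "complex^'n^'n \<Rightarrow> real \<Rightarrow> complex^'n^'n" where
  "psd_powr A \<alpha> = (THE B. \<exists>U d. unitary U \<and> (\<forall>i. 0 \<le> d i) \<and>
     A = U ** real_diag d ** dagger U \<and>
     B = U ** real_diag (\<lambda>i. d i powr \<alpha>) ** dagger U)"

text \<open>
  The trace below is real for positive semidefinite \<open>\<rho>\<close>; \<open>Re\<close> only changes the type.
  Logarithms are natural.
\<close>

definition renyi_entropy :: "real \<Rightarrow> complex^'n^'n \<Rightarrow> real" where
  "renyi_entropy \<alpha> \<rho> = 1 / (1 - \<alpha>) * ln (Re (trace (psd_powr \<rho> \<alpha>)))"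

text \<open>A finite ensemble \<open>{p\<^sub>k, \<rho>\<^sub>k}\<close> is the list of its pairs \<open>(p\<^sub>k, \<rho>\<^sub>k)\<close>.\<close>

type_synonym 'n ensemble = "(real \<times> (complex^'n^'n)) list"

definition jensen_shannon :: "real \<Rightarrow> 'n::finite ensemble \<Rightarrow> real" where
  "jensen_shannon \<alpha> \<xi> =
     renyi_entropy \<alpha> (\<Sum>(p, \<rho>)\<leftarrow>\<xi>. p *\<^sub>R \<rho>) - (\<Sum>(p, \<rho>)\<leftarrow>\<xi>. p * renyi_entropy \<alpha> \<rho>)"

definition povm :: "(complex^'n^'n) list \<Rightarrow> bool" where
  "povm Ms \<longleftrightarrow> (\<forall>M\<in>set Ms. psd M) \<and> sum_list Ms = mat 1"

text \<open>
  Each effect \<open>M\<close> yields the unnormalised operator \<open>\<omega> = Tr\<^sub>E ((I \<otimes> M) \<rho>)\<close> on \<open>A\<close>, whose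
  trace is the (real) probability of the outcome; outcomes of probability zero are dropped.
\<close>

definition created_ensemble ::
  "complex^('a::finite \<times> 'e::finite)^('a \<times> 'e) \<Rightarrow> (complex^'e^'e) list \<Rightarrow> 'a ensemble" where
  "created_ensemble \<rho> Ms =
     map (\<lambda>\<omega>. (Re (trace \<omega>), (1 / Re (trace \<omega>)) *\<^sub>R \<omega>))
       (filter (\<lambda>\<omega>. trace \<omega> \<noteq> 0) (map (\<lambda>M. ptrace_snd (tensor (mat 1) M ** \<rho>)) Ms))"

text \<open>
  For states and \<open>0 < \<alpha> < 1\<close> the sets under the following supremum and infimum are nonempty
  and bounded, because the entropies range over a bounded interval, so the real-valued
  \<open>SUP\<close> and \<open>INF\<close> are the genuine supremum and infimum.
\<close>

definition C_alpha :: "real \<Rightarrow> complex^('a::finite \<times> 'e::finite)^('a \<times> 'e) \<Rightarrow> real" where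
  "C_alpha \<alpha> \<rho> = (SUP Ms\<in>{Ms. povm Ms}. jensen_shannon \<alpha> (created_ensemble \<rho> Ms))"

definition pure_decomposition ::
  "complex^'n^'n \<Rightarrow> (real \<times> (complex^'n)) list \<Rightarrow> bool" where
  "pure_decomposition \<rho> ds \<longleftrightarrow>
     (\<forall>(p, \<phi>)\<in>set ds. 0 \<le> p \<and> norm \<phi> = 1) \<and> (\<Sum>(p, \<phi>)\<leftarrow>ds. p) = 1 \<and>
     \<rho> = (\<Sum>(p, \<phi>)\<leftarrow>ds. p *\<^sub>R ketbra \<phi>)"

definition E_formation :: "real \<Rightarrow> complex^('a::finite \<times> 'b::finite)^('a \<times> 'b) \<Rightarrow> real" where
  "E_formation \<alpha> \<rho> =
     (INF ds\<in>{ds. pure_decomposition \<rho> ds}.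
        \<Sum>(p, \<phi>)\<leftarrow>ds. p * renyi_entropy \<alpha> (ptrace_snd (ketbra \<phi>)))"

end

(* Write the pure state as a matrix \<Psi> from E to A \<otimes> B, so that \<rho>\<^sub>A\<^sub>B = \<Psi> \<Psi>\<^sup>\<dagger>, and an effect M on E leaves
   the unnormalised operator Tr\<^sub>B (\<Psi> M^T \<Psi>\<^sup>\<dagger>) on A. Let s(w) = (tr w) S(w / tr w) on positive operators;
   the divergence of the ensemble created by {M\<^sub>x} is S(\<rho>\<^sub>A) minus the sum of the s(w\<^sub>x), so the claim
   is that the infimum of this sum over POVMs is the entanglement of formation.

   For \<alpha> < 1, Peierls' inequality makes Tr \<rho>^\<alpha> and hence S concave, so s is superadditive: refining every
   effect into rank-one effects can only decrease the sum, and a rank-one POVM is a pure-state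
   decomposition of \<rho>\<^sub>A\<^sub>B. Conversely every pure-state decomposition of \<Psi> \<Psi>\<^sup>\<dagger> arises from a POVM,
   completed by an effect on the kernel of \<Psi> (Hughston, Jozsa and Wootters). *)

theory Submission
  imports Defs
begin

section \<open>Rectangular adjoints and the complex inner product\<close>

text \<open>\<open>dagger\<close> is typed for square matrices only, whereas the matrix of a
  purification maps E to A \<otimes> B and is rectangular.\<close>

definition adjoint_matrix :: "complex^'n^'m \<Rightarrow> complex^'m^'n" where
  "adjoint_matrix A = (\<chi> i j. cnj (A $ j $ i))"

lemma dagger_eq_adjoint: "dagger A = adjoint_matrix A"
  by (simp add: dagger_def adjoint_matrix_def)

lemma adjoint_adjoint [simp]: "adjoint_matrix (adjoint_matrix A) = A"
  by (simp add: adjoint_matrix_def vec_eq_iff)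

lemma adjoint_mult: "adjoint_matrix (A ** B) = adjoint_matrix B ** adjoint_matrix A"
  by (simp add: adjoint_matrix_def vec_eq_iff matrix_matrix_mult_def mult.commute)

lemma adjoint_mat_1 [simp]: "adjoint_matrix (mat 1) = mat 1"
  by (auto simp: adjoint_matrix_def vec_eq_iff mat_def)

lemma adjoint_add: "adjoint_matrix (A + B) = adjoint_matrix A + adjoint_matrix B"
  by (simp add: adjoint_matrix_def vec_eq_iff)

lemma adjoint_diff: "adjoint_matrix (A - B) = adjoint_matrix A - adjoint_matrix B"
  by (simp add: adjoint_matrix_def vec_eq_iff)

lemma adjoint_scaleR: "adjoint_matrix (c *\<^sub>R A) = c *\<^sub>R adjoint_matrix A"
  by (simp add: adjoint_matrix_def vec_eq_iff)

lemma adjoint_0 [simp]: "adjoint_matrix 0 = 0"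
  by (simp add: adjoint_matrix_def vec_eq_iff)

lemma adjoint_real_diag [simp]: "adjoint_matrix (real_diag d) = real_diag d"
  by (auto simp: adjoint_matrix_def real_diag_def vec_eq_iff)

lemma real_diag_mult: "real_diag d ** real_diag e = real_diag (\<lambda>i. d i * e i)"
  by (auto simp: real_diag_def vec_eq_iff matrix_matrix_mult_def if_distrib[of "\<lambda>x. x * _"]
      cong: if_cong)

lemma adjoint_ketbra [simp]: "adjoint_matrix (ketbra v) = ketbra v"
  by (simp add: adjoint_matrix_def ketbra_def vec_eq_iff)

lemma cinner_add_left: "cinner (u + v) w = cinner u w + cinner v w"
  by (simp add: cinner_def sum.distrib algebra_simps)

lemma cinner_add_right: "cinner u (v + w) = cinner u v + cinner u w"
  by (simp add: cinner_def sum.distrib algebra_simps)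

lemma cinner_diff_right: "cinner u (v - w) = cinner u v - cinner u w"
  by (simp add: cinner_def sum_subtractf algebra_simps)

lemma cinner_scaleR_left: "cinner (c *\<^sub>R u) v = of_real c * cinner u v"
  unfolding cinner_def sum_distrib_left by (rule sum.cong) (simp_all add: scaleR_conv_of_real[where 'a = complex])

lemma cinner_scaleR_right: "cinner u (c *\<^sub>R v) = of_real c * cinner u v"
  unfolding cinner_def sum_distrib_left by (rule sum.cong) (simp_all add: scaleR_conv_of_real[where 'a = complex])

lemma cinner_0_right [simp]: "cinner v 0 = 0"
  by (simp add: cinner_def)

lemma cnj_cinner: "cnj (cinner u v) = cinner v u"
  by (simp add: cinner_def mult.commute)

lemma cinner_self: "cinner v v = of_real ((norm v)\<^sup>2)"
proof -
  have "(norm v)\<^sup>2 = (\<Sum>i\<in>UNIV. (cmod (v $ i))\<^sup>2)"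
    by (simp add: norm_vec_def L2_set_def sum_nonneg)
  then show ?thesis
    by (simp add: cinner_def complex_norm_square[symmetric] mult.commute)
qed

lemma cinner_adjoint: "cinner (adjoint_matrix A *v u) v = cinner u (A *v v)"
proof -
  have "cinner (adjoint_matrix A *v u) v = (\<Sum>i\<in>UNIV. \<Sum>j\<in>UNIV. A $ j $ i * cnj (u $ j) * v $ i)"
    by (simp add: cinner_def matrix_vector_mult_def adjoint_matrix_def sum_distrib_right)
  also have "\<dots> = (\<Sum>j\<in>UNIV. \<Sum>i\<in>UNIV. A $ j $ i * cnj (u $ j) * v $ i)"
    by (rule sum.swap)
  also have "\<dots> = cinner u (A *v v)"
    by (simp add: cinner_def matrix_vector_mult_def sum_distrib_left mult_ac)
  finally show ?thesis .
qed

lemma continuous_on_cinner [continuous_intros]: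
  assumes "continuous_on S f" "continuous_on S g"
  shows "continuous_on S (\<lambda>x. cinner (f x) (g x))"
  unfolding cinner_def by (intro continuous_intros assms)

lemma mult_vec_scaleR: "A *v (c *\<^sub>R v) = c *\<^sub>R (A *v (v :: complex^'n))"
  by (simp add: matrix_vector_mult_def vec_eq_iff scaleR_sum_right)

section \<open>The spectral theorem for Hermitian matrices\<close>

text \<open>The square matrix whose row i is the conjugate of \<open>u i\<close> for i in S, and
  zero otherwise, has the zero row x. Hence it is singular, and any nonzero kernel vector
  serves.\<close>

lemma exists_orthogonal_vector:
  fixes u :: "'n::finite \<Rightarrow> complex^'n"
  assumes "x \<notin> S"
  shows "\<exists>v. v \<noteq> 0 \<and> (\<forall>i\<in>S. cinner (u i) v = 0)"
proof -
  define A :: "complex^'n^'n" where "A = (\<chi> i j. if i \<in> S then cnj (u i $ j) else 0)"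
  have "\<nexists>B. B ** A = mat 1"
  proof
    assume "\<exists>B. B ** A = mat 1"
    then obtain B where "A ** B = mat 1"
      using matrix_left_right_inverse by blast
    then have "(A ** B) $ x $ x = 1"
      by (simp add: mat_def)
    then show False
      using assms by (simp add: matrix_matrix_mult_def A_def)
  qed
  then obtain v where v: "A *v v = 0" "v \<noteq> 0"
    unfolding matrix_left_invertible_ker by blast
  have "cinner (u i) v = 0" if "i \<in> S" for i
  proof -
    have "(A *v v) $ i = cinner (u i) v"
      using that by (simp add: matrix_vector_mult_def A_def cinner_def)
    with v show ?thesis by simp
  qed
  with v show ?thesis by blast
qed

text \<open>First-order condition: the quadratic in t attains its minimum 0 at t = 0, so its
  derivative 2 b vanishes there. Otherwise a small step against b, scaled by some s above c, makes
  it negative.\<close>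

lemma linear_part_eq_0:
  fixes b c :: real
  assumes "\<And>t. 0 \<le> 2 * t * b + t\<^sup>2 * c"
  shows "b = 0"
proof (rule ccontr)
  assume b: "b \<noteq> 0"
  define s where "s = \<bar>c\<bar> + 1"
  have s: "s > 0" "c < s" by (auto simp: s_def)
  have "2 * (- b / s) * b + (- b / s)\<^sup>2 * c = b\<^sup>2 * (c - 2 * s) / s\<^sup>2"
    using s by (simp add: field_simps power2_eq_square)
  also have "\<dots> < 0"
    using s b by (intro divide_neg_pos mult_pos_neg) auto
  finally show False using assms[of "- b / s"] by simp
qed

text \<open>The vector maximising the Rayleigh quotient on the orthogonal complement of the
  eigenvectors found so far is a further eigenvector.\<close>

lemma hermitian_new_eigenvector:
  fixes u :: "'n::finite \<Rightarrow> complex^'n"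
  assumes herm: "adjoint_matrix A = A" and "x \<notin> S"
    and eig: "\<And>i. i \<in> S \<Longrightarrow> A *v u i = d i *\<^sub>R u i"
  shows "\<exists>v l. norm v = 1 \<and> (\<forall>i\<in>S. cinner (u i) v = 0) \<and> A *v v = l *\<^sub>R v"
proof -
  define W where "W = {v. \<forall>i\<in>S. cinner (u i) v = 0}"
  define q where "q v = Re (cinner v (A *v v))" for v
  have W_scale: "c *\<^sub>R v \<in> W" if "v \<in> W" for c v
    using that by (simp add: W_def cinner_scaleR_right)
  have W_add: "v + w \<in> W" if "v \<in> W" "w \<in> W" for v w
    using that by (simp add: W_def cinner_add_right)
  have W_A: "A *v v \<in> W" if "v \<in> W" for v
  proof -
    have "cinner (u i) (A *v v) = 0" if "i \<in> S" for i
    proof -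
      have "cinner (u i) (A *v v) = cinner (A *v u i) v"
        using cinner_adjoint[of A "u i" v] herm by simp
      then show ?thesis
        using eig[OF that] \<open>v \<in> W\<close> that by (simp add: cinner_scaleR_left W_def)
    qed
    then show ?thesis by (simp add: W_def)
  qed
  have q_scale: "q (c *\<^sub>R v) = c\<^sup>2 * q v" for c v
    by (simp add: q_def mult_vec_scaleR cinner_scaleR_left cinner_scaleR_right power2_eq_square)
  have "closed W"
    unfolding W_def Collect_ball_eq by (intro closed_INT ballI closed_Collect_eq continuous_intros)
  then have "compact (sphere 0 1 \<inter> W)"
    by (intro compact_Int_closed) auto
  moreover have "continuous_on (sphere 0 1 \<inter> W) q"
    unfolding q_def by (intro continuous_intros linear_continuous_on) auto
  moreover obtain w where "w \<noteq> 0" "w \<in> W"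
    using exists_orthogonal_vector[OF \<open>x \<notin> S\<close>, of u] by (auto simp: W_def)
  then have "(1 / norm w) *\<^sub>R w \<in> sphere 0 1 \<inter> W"
    using W_scale by auto
  ultimately obtain v where v: "norm v = 1" "v \<in> W" and vmax: "\<And>w. w \<in> W \<Longrightarrow> norm w = 1 \<Longrightarrow> q w \<le> q v"
    using continuous_attains_sup[of "sphere 0 1 \<inter> W" q] by fastforce
  \<comment> \<open>\<open>q\<close> is homogeneous of degree two, so the maximum on the unit sphere
    bounds it on all of W.\<close>
  have le: "q w \<le> q v * (norm w)\<^sup>2" if "w \<in> W" for w
  proof (cases "w = 0")
    case False
    have "q ((1 / norm w) *\<^sub>R w) \<le> q v"
      using False by (intro vmax W_scale that) auto
    then show ?thesis
      using False unfolding q_scale by (simp add: field_simps)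
  qed (simp add: q_def)
  \<comment> \<open>The residual of the eigenvector equation, itself in W. Moving from v to v + t w,
    the gap in the bound \<open>le\<close> has linear term 2 t |w|^2, so the first-order condition
    forces w = 0.\<close>
  define w where "w = q v *\<^sub>R v - A *v v"
  have w: "w \<in> W"
    using W_add[OF W_scale[OF v(2), of "q v"] W_scale[OF W_A[OF v(2)], of "-1"]] by (simp add: w_def)
  have "0 \<le> 2 * t * (norm w)\<^sup>2 + t\<^sup>2 * (q v * (norm w)\<^sup>2 - q w)" for t
  proof -
    have "v + t *\<^sub>R w \<in> W"
      by (intro W_add W_scale v w)
    then have "q (v + t *\<^sub>R w) \<le> q v * (norm (v + t *\<^sub>R w))\<^sup>2"
      by (rule le)
    moreover have "q (v + t *\<^sub>R w) = q v + 2 * t * Re (cinner w (A *v v)) + t\<^sup>2 * q w"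
    proof -
      have "Re (cinner v (A *v w)) = Re (cinner w (A *v v))"
        using cinner_adjoint[of A v w] cnj_cinner[of w "A *v v"] herm by (metis cnj.simps(1))
      then show ?thesis
        by (simp add: q_def matrix_vector_right_distrib mult_vec_scaleR cinner_add_left
            cinner_add_right cinner_scaleR_left cinner_scaleR_right algebra_simps power2_eq_square)
    qed
    moreover have "(norm (v + t *\<^sub>R w))\<^sup>2 = 1 + 2 * t * Re (cinner w v) + t\<^sup>2 * (norm w)\<^sup>2"
    proof -
      have "Re (cinner v w) = Re (cinner w v)"
        using cnj_cinner[of v w] by (metis cnj.simps(1))
      moreover have "(norm z)\<^sup>2 = Re (cinner z z)" for z :: "complex^'n"
        by (simp add: cinner_self)
      ultimately show ?thesis
        using v(1) by (simp add: cinner_add_left cinner_add_right cinner_scaleR_left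
            cinner_scaleR_right algebra_simps power2_eq_square cinner_self[of v])
    qed
    moreover have "(norm w)\<^sup>2 = q v * Re (cinner w v) - Re (cinner w (A *v v))"
    proof -
      have "(norm w)\<^sup>2 = Re (cinner w w)"
        by (simp add: cinner_self)
      also have "\<dots> = Re (cinner w (q v *\<^sub>R v - A *v v))"
        by (simp add: w_def)
      finally show ?thesis
        by (simp add: cinner_diff_right cinner_scaleR_right)
    qed
    moreover from this have "2 * t * (norm w)\<^sup>2 = 2 * t * (q v * Re (cinner w v)) - 2 * t * Re (cinner w (A *v v))"
      by (simp only: right_diff_distrib)
    ultimately show ?thesis
      by (simp only: distrib_left right_diff_distrib mult_ac)
  qed
  then have "(norm w)\<^sup>2 = 0"
    by (rule linear_part_eq_0)
  then have "A *v v = q v *\<^sub>R v"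
    by (simp add: w_def)
  with v show ?thesis
    by (auto simp: W_def)
qed

text \<open>Induction on the set of indices already served: each new index receives a unit
  eigenvector orthogonal to the earlier ones. Taking S = UNIV gives an eigenbasis indexed by the
  coordinates.\<close>

lemma hermitian_eigenbasis:
  fixes S :: "'n::finite set"
  assumes herm: "adjoint_matrix (A :: complex^'n^'n) = A"
  shows "\<exists>u d. (\<forall>i\<in>S. A *v u i = d i *\<^sub>R u i) \<and>
    (\<forall>i\<in>S. \<forall>j\<in>S. cinner (u i) (u j) = (if i = j then 1 else 0))"
  using finite[of S]
proof (induction S)
  case empty
  then show ?case by simp
next
  case (insert x S)
  then obtain u d where ud: "\<And>i. i \<in> S \<Longrightarrow> A *v u i = d i *\<^sub>R u i"
    "\<And>i j. i \<in> S \<Longrightarrow> j \<in> S \<Longrightarrow> cinner (u i) (u j) = (if i = j then 1 else 0)"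
    by blast
  obtain v l where v: "norm v = 1" "\<And>i. i \<in> S \<Longrightarrow> cinner (u i) v = 0" "A *v v = l *\<^sub>R v"
    using hermitian_new_eigenvector[OF herm insert(2), of u d] ud(1) by blast
  have v': "cinner v (u i) = 0" if "i \<in> S" for i
    using v(2)[OF that] cnj_cinner[of "u i" v] by simp
  show ?case
    by (rule exI[of _ "u(x := v)"], rule exI[of _ "d(x := l)"])
      (use insert(2) ud v v' cinner_self[of v] in \<open>auto simp del: One_nat_def\<close>)
qed

lemma unitary_iff_left: "unitary U \<longleftrightarrow> adjoint_matrix U ** U = mat 1"
  using matrix_left_right_inverse[of "adjoint_matrix U" U]
  by (auto simp: unitary_def dagger_eq_adjoint)

theorem hermitian_spectral:
  assumes herm: "adjoint_matrix (A :: complex^'n^'n) = A"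
  shows "\<exists>U d. unitary U \<and> A = U ** real_diag d ** adjoint_matrix U"
proof -
  obtain u :: "'n \<Rightarrow> complex^'n" and d where eig: "\<And>i. A *v u i = d i *\<^sub>R u i"
    and orth: "\<And>i j. cinner (u i) (u j) = (if i = j then 1 else 0)"
    using hermitian_eigenbasis[OF herm, of UNIV] by auto
  define U where "U = (\<chi> i j. u j $ i)"
  have "adjoint_matrix U ** U = mat 1"
    using orth by (simp add: vec_eq_iff matrix_matrix_mult_def adjoint_matrix_def U_def mat_def cinner_def)
  then have U: "unitary U"
    by (simp add: unitary_iff_left)
  have "A ** U = U ** real_diag d"
  proof -
    have "(A ** U) $ i $ j = (U ** real_diag d) $ i $ j" for i j
    proof -
      have "(A ** U) $ i $ j = (A *v u j) $ i"
        by (simp add: matrix_matrix_mult_def matrix_vector_mult_def U_def)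
      also have "\<dots> = of_real (d j) * u j $ i"
        by (simp add: eig scaleR_conv_of_real[where 'a = complex])
      also have "\<dots> = (U ** real_diag d) $ i $ j"
        by (simp add: matrix_matrix_mult_def U_def real_diag_def if_distrib[of "\<lambda>x. _ * x"] cong: if_cong)
      finally show ?thesis .
    qed
    then show ?thesis by (simp add: vec_eq_iff)
  qed
  then have "U ** real_diag d ** adjoint_matrix U = A ** (U ** adjoint_matrix U)"
    by (simp add: matrix_mul_assoc)
  then have "U ** real_diag d ** adjoint_matrix U = A"
    using U by (simp add: unitary_def dagger_eq_adjoint)
  with U show ?thesis by metis
qed

section \<open>Positive semidefinite matrices and their powers by spectral calculus\<close>

lemma psd_def': "psd A \<longleftrightarrow> adjoint_matrix A = A \<and> (\<forall>v. 0 \<le> Re (cinner v (A *v v)))"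
  by (simp add: psd_def dagger_eq_adjoint)

lemma unitaryD:
  assumes "unitary U"
  shows "adjoint_matrix U ** U = mat 1" "U ** adjoint_matrix U = mat 1"
  using assms by (auto simp: unitary_def dagger_eq_adjoint)

lemma unitary_cancel:
  assumes "unitary U"
  shows "A ** U ** adjoint_matrix U = A" "A ** adjoint_matrix U ** U = A"
  using unitaryD[OF assms] by (simp_all flip: matrix_mul_assoc)

lemma unitary_adjoint_mult:
  assumes "unitary U" "unitary V"
  shows "unitary (adjoint_matrix U ** V)"
  using assms by (simp add: unitary_iff_left adjoint_mult matrix_mul_assoc unitary_cancel)

lemma matrix_mult_component: "(A ** B) $ i $ j = (\<Sum>k\<in>UNIV. A $ i $ k * B $ k $ j)"
  by (simp add: matrix_matrix_mult_def)

lemma mult_real_diag_component: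
  "(A ** real_diag d) $ i $ j = A $ i $ j * of_real (d j)"
  by (simp add: matrix_mult_component real_diag_def if_distrib[of "\<lambda>x. _ * x"] cong: if_cong)

lemma real_diag_mult_component:
  "(real_diag d ** A) $ i $ j = of_real (d i) * A $ i $ j"
  by (simp add: matrix_mult_component real_diag_def if_distrib[of "\<lambda>x. x * _"] cong: if_cong)

lemma adjoint_component: "adjoint_matrix A $ i $ j = cnj (A $ j $ i)"
  by (simp add: adjoint_matrix_def)

lemma adjoint_conj_diag:
  "(adjoint_matrix B ** A ** B) $ i $ i = cinner (column i B) (A *v column i B)"
proof -
  have "(adjoint_matrix B ** (A ** B)) $ i $ i = cinner (column i B) (A *v column i B)"
    by (simp add: matrix_mult_component adjoint_component cinner_def column_def matrix_vector_mult_def)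
  then show ?thesis by (simp add: matrix_mul_assoc)
qed

lemma psd_spectral:
  assumes "psd A"
  obtains U d where "unitary U" "\<And>i. 0 \<le> d i" "A = U ** real_diag d ** adjoint_matrix U"
proof -
  obtain U d where U: "unitary U" and A: "A = U ** real_diag d ** adjoint_matrix U"
    using hermitian_spectral[of A] assms by (auto simp: psd_def')
  have "adjoint_matrix U ** A ** U = real_diag d"
    using U by (simp add: A matrix_mul_assoc unitary_cancel unitaryD)
  \<comment> \<open>Each eigenvalue is the quadratic form of A at the matching column of U, so
    positivity of A makes it nonnegative.\<close>
  then have "complex_of_real (d i) = cinner (column i U) (A *v column i U)" for i
    using adjoint_conj_diag[of U A i] by (simp add: real_diag_def)
  then have "d i = Re (cinner (column i U) (A *v column i U))" for i
    by (metis Re_complex_of_real)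
  then have "0 \<le> d i" for i
    using assms by (simp add: psd_def')
  with U A show thesis by (intro that) auto
qed

text \<open>Two diagonalisations differ by a unitary intertwining the diagonal matrices; such a matrix
  has nonzero entries only between equal eigenvalues, hence intertwines every function of them.\<close>

lemma spectral_function_unique:
  assumes U: "unitary U" and V: "unitary V"
    and eq: "U ** real_diag d ** adjoint_matrix U = V ** real_diag e ** adjoint_matrix V"
  shows "U ** real_diag (\<lambda>i. f (d i)) ** adjoint_matrix U = V ** real_diag (\<lambda>i. f (e i)) ** adjoint_matrix V"
proof -
  define W where "W = adjoint_matrix V ** U"
  have "W ** real_diag d = adjoint_matrix V ** (U ** real_diag d ** adjoint_matrix U) ** U"
    using U by (simp add: W_def matrix_mul_assoc unitary_cancel)
  also have "\<dots> = real_diag e ** W"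
    unfolding eq using V by (simp add: W_def matrix_mul_assoc unitaryD)
  finally have comm: "W ** real_diag d = real_diag e ** W" .
  have "W $ i $ j * of_real (f (d j)) = of_real (f (e i)) * W $ i $ j" for i j
  proof -
    have "W $ i $ j * of_real (d j) = of_real (e i) * W $ i $ j"
      using arg_cong[OF comm, of "\<lambda>M. M $ i $ j"]
      by (simp add: mult_real_diag_component real_diag_mult_component)
    then have "W $ i $ j = 0 \<or> d j = e i"
      by (auto simp: mult.commute)
    then show ?thesis by auto
  qed
  then have comm': "W ** real_diag (\<lambda>i. f (d i)) = real_diag (\<lambda>i. f (e i)) ** W"
    by (simp add: vec_eq_iff mult_real_diag_component real_diag_mult_component)
  have "U = V ** W" "adjoint_matrix V = W ** adjoint_matrix U"
    using U V by (simp_all add: W_def matrix_mul_assoc unitary_cancel unitaryD)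
  then have "V ** real_diag (\<lambda>i. f (e i)) ** adjoint_matrix V
      = V ** (real_diag (\<lambda>i. f (e i)) ** W) ** adjoint_matrix U"
    by (simp add: matrix_mul_assoc)
  also have "\<dots> = V ** W ** real_diag (\<lambda>i. f (d i)) ** adjoint_matrix U"
    by (simp add: comm'[symmetric] matrix_mul_assoc)
  finally show ?thesis
    using \<open>U = V ** W\<close> by simp
qed

text \<open>Discharges the definite description in \<open>psd_powr\<close>: the given decomposition
  is a witness, and \<open>spectral_function_unique\<close> shows that every other one yields the
  same matrix.\<close>

lemma psd_powr_eq:
  assumes "unitary U" "\<And>i. 0 \<le> d i" "A = U ** real_diag d ** adjoint_matrix U"
  shows "psd_powr A \<alpha> = U ** real_diag (\<lambda>i. d i powr \<alpha>) ** adjoint_matrix U"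
  unfolding psd_powr_def
proof (rule the_equality)
  show "\<exists>U' d'. unitary U' \<and> (\<forall>i. 0 \<le> d' i) \<and> A = U' ** real_diag d' ** dagger U' \<and>
     U ** real_diag (\<lambda>i. d i powr \<alpha>) ** adjoint_matrix U = U' ** real_diag (\<lambda>i. d' i powr \<alpha>) ** dagger U'"
    using assms by (intro exI[of _ U] exI[of _ d]) (simp add: dagger_eq_adjoint)
next
  fix B
  assume "\<exists>U' d'. unitary U' \<and> (\<forall>i. 0 \<le> d' i) \<and> A = U' ** real_diag d' ** dagger U' \<and>
     B = U' ** real_diag (\<lambda>i. d' i powr \<alpha>) ** dagger U'"
  then obtain U' d' where "unitary U'" "A = U' ** real_diag d' ** adjoint_matrix U'"
    and B: "B = U' ** real_diag (\<lambda>i. d' i powr \<alpha>) ** adjoint_matrix U'"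
    by (auto simp: dagger_eq_adjoint)
  then show "B = U ** real_diag (\<lambda>i. d i powr \<alpha>) ** adjoint_matrix U"
    unfolding B using assms by (intro spectral_function_unique[where f = "\<lambda>x. x powr \<alpha>"]) auto
qed

lemma trace_unitary_conj:
  assumes "unitary U"
  shows "trace (U ** real_diag d ** adjoint_matrix U) = of_real (\<Sum>i\<in>UNIV. d i)"
proof -
  have "trace (U ** real_diag d ** adjoint_matrix U) = trace (adjoint_matrix U ** (U ** real_diag d))"
    by (rule trace_mul_sym)
  also have "\<dots> = trace (real_diag d)"
    using assms by (simp add: matrix_mul_assoc unitaryD)
  finally show ?thesis
    by (simp add: trace_def real_diag_def)
qed

definition power_trace :: "real \<Rightarrow> complex^'n^'n \<Rightarrow> real" where
  "power_trace \<alpha> A = Re (trace (psd_powr A \<alpha>))"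

lemma power_trace_eq:
  assumes "unitary U" "\<And>i. 0 \<le> d i" "A = U ** real_diag d ** adjoint_matrix U"
  shows "power_trace \<alpha> A = (\<Sum>i\<in>UNIV. d i powr \<alpha>)"
  unfolding power_trace_def psd_powr_eq[OF assms] trace_unitary_conj[OF assms(1)] by simp

section \<open>Concavity of the trace of a power\<close>

text \<open>The sign of the second derivative settles positive arguments. The function is not
  differentiable at 0, so that endpoint is treated apart: there the claim reduces to c \<le> c powr
  \<alpha> for c in [0, 1].\<close>

lemma powr_concave_le:
  fixes x y s \<alpha> :: real
  assumes "0 < \<alpha>" "\<alpha> < 1" "0 \<le> x" "0 \<le> y" "0 \<le> s" "s \<le> 1"
  shows "(1 - s) * x powr \<alpha> + s * y powr \<alpha> \<le> ((1 - s) * x + s * y) powr \<alpha>"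
proof -
  have scale: "c * z powr \<alpha> \<le> (c * z) powr \<alpha>" if "0 \<le> c" "c \<le> 1" "0 \<le> z" for c z
  proof (cases "c = 0")
    case False
    have "c powr 1 \<le> c powr \<alpha>"
      using that False assms by (intro powr_mono') auto
    then show ?thesis
      using that False by (simp add: powr_mult mult_right_mono)
  qed simp
  have conc: "concave_on {0<..} (\<lambda>x::real. x powr \<alpha>)"
  proof (rule f''_le0_imp_concave)
    show "((\<lambda>x. x powr \<alpha>) has_real_derivative \<alpha> * x powr (\<alpha> - 1)) (at x)" if "x \<in> {0<..}" for x
      using that by (auto intro!: derivative_eq_intros)
    show "((\<lambda>x. \<alpha> * x powr (\<alpha> - 1)) has_real_derivative \<alpha> * ((\<alpha> - 1) * x powr (\<alpha> - 1 - 1))) (at x)"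
      if "x \<in> {0<..}" for x
      using that by (auto intro!: derivative_eq_intros)
    show "\<alpha> * ((\<alpha> - 1) * x powr (\<alpha> - 1 - 1)) \<le> 0" for x
      using assms by (intro mult_nonneg_nonpos mult_nonpos_nonneg) auto
  qed auto
  show ?thesis
  proof (cases "x = 0 \<or> y = 0")
    case True
    then show ?thesis
      using scale[of s y] scale[of "1 - s" x] assms by auto
  next
    case False
    then show ?thesis
      using concave_onD[OF conc, of s x y] assms by simp
  qed
qed

lemma concave_on_powr:
  fixes \<alpha> :: real
  assumes "0 < \<alpha>" "\<alpha> < 1"
  shows "concave_on {0..} (\<lambda>x. x powr \<alpha>)"
  unfolding concave_on_iff
proof (intro conjI ballI allI impI)
  fix x y u v :: real
  assume "x \<in> {0..}" "y \<in> {0..}" "0 \<le> u" "0 \<le> v" "u + v = 1"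
  moreover from this have "u = 1 - v" by simp
  ultimately show "u * x powr \<alpha> + v * y powr \<alpha> \<le> (u *\<^sub>R x + v *\<^sub>R y) powr \<alpha>"
    using powr_concave_le[OF assms, of x y v] by simp
qed simp

lemma unitary_row_sum:
  assumes "unitary W"
  shows "(\<Sum>j\<in>UNIV. (cmod (W $ i $ j))\<^sup>2) = 1"
proof -
  have "complex_of_real (\<Sum>j\<in>UNIV. (cmod (W $ i $ j))\<^sup>2) = (W ** adjoint_matrix W) $ i $ i"
    by (simp add: matrix_mult_component adjoint_component complex_norm_square[symmetric])
  also have "\<dots> = 1"
    using assms by (simp add: unitaryD mat_def)
  finally show ?thesis
    using of_real_eq_1_iff by blast
qed

lemma unitary_column_sum:
  assumes "unitary W"
  shows "(\<Sum>i\<in>UNIV. (cmod (W $ i $ j))\<^sup>2) = 1"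
proof -
  have "complex_of_real (\<Sum>i\<in>UNIV. (cmod (W $ i $ j))\<^sup>2) = (adjoint_matrix W ** W) $ j $ j"
    by (simp add: matrix_mult_component adjoint_component complex_norm_square[symmetric] mult.commute)
  also have "\<dots> = 1"
    using assms by (simp add: unitaryD mat_def)
  finally show ?thesis
    using of_real_eq_1_iff by blast
qed

text \<open>Peierls' inequality: the diagonal of a matrix in any orthonormal basis is a doubly stochastic
  average of its eigenvalues.\<close>

lemma power_trace_le_diagonal:
  assumes "psd A" "unitary U" "0 < \<alpha>" "\<alpha> < 1"
  shows "power_trace \<alpha> A \<le> (\<Sum>i\<in>UNIV. Re ((adjoint_matrix U ** A ** U) $ i $ i) powr \<alpha>)"
proof -
  obtain V e where V: "unitary V" and e: "\<And>i. 0 \<le> e i" and A: "A = V ** real_diag e ** adjoint_matrix V"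
    using psd_spectral[OF assms(1)] by blast
  define W where "W = adjoint_matrix U ** V"
  have W: "unitary W"
    unfolding W_def by (intro unitary_adjoint_mult assms V)
  have "adjoint_matrix U ** A ** U = W ** real_diag e ** adjoint_matrix W"
    by (simp add: A W_def adjoint_mult matrix_mul_assoc)
  moreover have "(W ** real_diag e ** adjoint_matrix W) $ i $ i
      = of_real (\<Sum>j\<in>UNIV. (cmod (W $ i $ j))\<^sup>2 * e j)" for i
  proof -
    have "(W ** real_diag e ** adjoint_matrix W) $ i $ i
        = (\<Sum>j\<in>UNIV. (W $ i $ j * cnj (W $ i $ j)) * of_real (e j))"
      by (simp add: matrix_mult_component[of "W ** real_diag e"] mult_real_diag_component
          adjoint_component mult_ac)
    then show ?thesis
      by (simp add: complex_norm_square[symmetric])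
  qed
  ultimately have diag: "Re ((adjoint_matrix U ** A ** U) $ i $ i) = (\<Sum>j\<in>UNIV. (cmod (W $ i $ j))\<^sup>2 * e j)" for i
    by simp
  have "power_trace \<alpha> A = (\<Sum>j\<in>UNIV. e j powr \<alpha>)"
    by (rule power_trace_eq[OF V e A])
  \<comment> \<open>Unit column sums insert the weights for free. After exchanging the sums, unit
    row sums make each inner sum a convex combination, to which Jensen's inequality applies.\<close>
  also have "\<dots> = (\<Sum>j\<in>UNIV. \<Sum>i\<in>UNIV. (cmod (W $ i $ j))\<^sup>2 * e j powr \<alpha>)"
    by (simp add: unitary_column_sum[OF W] flip: sum_distrib_right)
  also have "\<dots> = (\<Sum>i\<in>UNIV. \<Sum>j\<in>UNIV. (cmod (W $ i $ j))\<^sup>2 * e j powr \<alpha>)"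
    by (rule sum.swap)
  also have "\<dots> \<le> (\<Sum>i\<in>UNIV. (\<Sum>j\<in>UNIV. (cmod (W $ i $ j))\<^sup>2 *\<^sub>R e j) powr \<alpha>)"
    using e by (intro sum_mono concave_on_sum[OF _ _ concave_on_powr[OF assms(3,4)]])
      (auto simp: unitary_row_sum[OF W])
  finally show ?thesis
    by (simp add: diag)
qed

lemma psd_add: "psd A \<Longrightarrow> psd B \<Longrightarrow> psd (A + B)"
  by (simp add: psd_def' adjoint_add matrix_vector_mult_add_rdistrib cinner_add_right)

lemma scaleR_mult_vec: "(c *\<^sub>R A) *v v = c *\<^sub>R (A *v (v :: complex^'n))"
  by (simp add: matrix_vector_mult_def vec_eq_iff scaleR_sum_right)

lemma psd_scaleR: "psd A \<Longrightarrow> 0 \<le> c \<Longrightarrow> psd (c *\<^sub>R A)"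
  by (simp add: psd_def' adjoint_scaleR scaleR_mult_vec cinner_scaleR_right)

lemma psd_0: "psd 0"
  by (simp add: psd_def')

text \<open>In an eigenbasis of the mixture C, the diagonal of C consists of its eigenvalues, while
  Peierls' inequality bounds the power traces of A and B by their diagonals. Scalar concavity, entry
  by entry, then compares the diagonals.\<close>

lemma power_trace_concave:
  assumes A: "psd A" and B: "psd B" and \<alpha>: "0 < \<alpha>" "\<alpha> < 1" and s: "0 \<le> s" "s \<le> 1"
  shows "(1 - s) * power_trace \<alpha> A + s * power_trace \<alpha> B \<le> power_trace \<alpha> ((1 - s) *\<^sub>R A + s *\<^sub>R B)"
proof -
  define C where "C = (1 - s) *\<^sub>R A + s *\<^sub>R B"
  have "psd C"
    unfolding C_def using s by (intro psd_add psd_scaleR A B) auto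
  then obtain U d where U: "unitary U" and d: "\<And>i. 0 \<le> d i" and C: "C = U ** real_diag d ** adjoint_matrix U"
    using psd_spectral by blast
  define diag where "diag M i = Re ((adjoint_matrix U ** M ** U) $ i $ i)" for M i
  have diag_nonneg: "0 \<le> diag M i" if "psd M" for M i
    using that unfolding diag_def adjoint_conj_diag by (simp add: psd_def')
  have diag_C: "diag C i = (1 - s) * diag A i + s * diag B i" for i
    unfolding diag_def adjoint_conj_diag C_def
    by (simp add: matrix_vector_mult_add_rdistrib scaleR_mult_vec cinner_add_right cinner_scaleR_right)
  have "adjoint_matrix U ** C ** U = real_diag d"
    using U by (simp add: C matrix_mul_assoc unitary_cancel unitaryD)
  then have d_eq: "d i = diag C i" for i
    by (simp add: diag_def real_diag_def)
  have "(1 - s) * power_trace \<alpha> A + s * power_trace \<alpha> B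
      \<le> (1 - s) * (\<Sum>i\<in>UNIV. diag A i powr \<alpha>) + s * (\<Sum>i\<in>UNIV. diag B i powr \<alpha>)"
    unfolding diag_def using s
    by (intro add_mono mult_left_mono power_trace_le_diagonal A B U \<alpha>) auto
  also have "\<dots> = (\<Sum>i\<in>UNIV. (1 - s) * diag A i powr \<alpha> + s * diag B i powr \<alpha>)"
    by (simp add: sum_distrib_left sum.distrib)
  also have "\<dots> \<le> (\<Sum>i\<in>UNIV. diag C i powr \<alpha>)"
    unfolding diag_C by (intro sum_mono powr_concave_le \<alpha> s diag_nonneg A B)
  also have "\<dots> = power_trace \<alpha> C"
    using power_trace_eq[OF U d C] by (simp add: d_eq)
  finally show ?thesis by (simp add: C_def)
qed

section \<open>Positivity and concavity of the Renyi entropy\<close>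

lemma trace_scaleR: "trace (c *\<^sub>R A) = c *\<^sub>R trace (A :: complex^'n^'n)"
  by (simp add: trace_def scaleR_sum_right)

lemma psd_trace:
  assumes "psd A"
  shows "trace A = of_real (Re (trace A))" "0 \<le> Re (trace A)"
proof -
  obtain U d where "unitary U" "\<And>i. 0 \<le> d i" "A = U ** real_diag d ** adjoint_matrix U"
    using psd_spectral[OF assms] by blast
  then show "trace A = of_real (Re (trace A))" "0 \<le> Re (trace A)"
    by (auto simp: trace_unitary_conj simp del: of_real_sum intro: sum_nonneg)
qed

text \<open>A positive trace leaves a nonzero eigenvalue, whose power is positive. This keeps the
  argument of the logarithm in the entropy positive.\<close>

lemma power_trace_pos:
  assumes "psd A" "0 < Re (trace A)"
  shows "0 < power_trace \<alpha> A"
proof -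
  obtain U d where U: "unitary U" and d: "\<And>i. 0 \<le> d i" and A: "A = U ** real_diag d ** adjoint_matrix U"
    using psd_spectral[OF assms(1)] by blast
  have "(\<Sum>i\<in>UNIV. d i) \<noteq> 0"
    using assms(2) by (simp add: A trace_unitary_conj[OF U] del: of_real_sum)
  then obtain i where "d i \<noteq> 0"
    by (meson sum.neutral)
  then have "0 < (\<Sum>i\<in>UNIV. d i powr \<alpha>)"
    by (intro sum_pos2[of _ i]) auto
  then show ?thesis
    by (simp add: power_trace_eq[OF U d A])
qed

lemma renyi_entropy_eq: "renyi_entropy \<alpha> A = ln (power_trace \<alpha> A) / (1 - \<alpha>)"
  by (simp add: renyi_entropy_def power_trace_def)

text \<open>The logarithm is concave and increasing, so composing it with the concave power trace
  stays concave; the factor 1 / (1 - \<alpha>) is positive because \<alpha> < 1.\<close>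

lemma renyi_entropy_concave:
  assumes A: "psd A" "0 < Re (trace A)" and B: "psd B" "0 < Re (trace B)"
    and \<alpha>: "0 < \<alpha>" "\<alpha> < 1" and s: "0 \<le> s" "s \<le> 1"
  shows "(1 - s) * renyi_entropy \<alpha> A + s * renyi_entropy \<alpha> B \<le> renyi_entropy \<alpha> ((1 - s) *\<^sub>R A + s *\<^sub>R B)"
proof -
  note pos = power_trace_pos[OF A, of \<alpha>] power_trace_pos[OF B, of \<alpha>]
  have mix: "0 < (1 - s) * power_trace \<alpha> A + s * power_trace \<alpha> B"
  proof (cases "s = 1")
    case False
    then show ?thesis using pos s by (intro add_pos_nonneg mult_pos_pos mult_nonneg_nonneg) auto
  qed (use pos in simp)
  have "(1 - s) * ln (power_trace \<alpha> A) + s * ln (power_trace \<alpha> B)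
      \<le> ln ((1 - s) * power_trace \<alpha> A + s * power_trace \<alpha> B)"
    using concave_onD[OF ln_concave, of s "power_trace \<alpha> A" "power_trace \<alpha> B"] pos s by simp
  also have "\<dots> \<le> ln (power_trace \<alpha> ((1 - s) *\<^sub>R A + s *\<^sub>R B))"
    using mix power_trace_concave[OF A(1) B(1) \<alpha> s] by (intro ln_mono) auto
  finally show ?thesis
    using \<alpha> by (simp add: renyi_entropy_eq divide_right_mono flip: add_divide_distrib)
qed

text \<open>The eigenvalues of a state lie in [0, 1], where d \<le> d powr \<alpha>, so the power
  trace is at least 1. This bound later makes the supremum and the infimum genuine.\<close>

lemma renyi_entropy_nonneg:
  assumes A: "psd A" "Re (trace A) = 1" and \<alpha>: "0 < \<alpha>" "\<alpha> < 1"
  shows "0 \<le> renyi_entropy \<alpha> A"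
proof -
  obtain U d where U: "unitary U" and d: "\<And>i. 0 \<le> d i" and eq: "A = U ** real_diag d ** adjoint_matrix U"
    using psd_spectral[OF A(1)] by blast
  have sum: "(\<Sum>i\<in>UNIV. d i) = 1"
    using A(2) by (simp add: eq trace_unitary_conj[OF U] del: of_real_sum)
  have "d i \<le> d i powr \<alpha>" for i
  proof (cases "d i = 0")
    case False
    have "d i \<le> 1"
      using sum_nonneg_leq_bound[of UNIV d 1 i] sum d by simp
    then have "d i powr 1 \<le> d i powr \<alpha>"
      using False d[of i] \<alpha> by (intro powr_mono') auto
    then show ?thesis using d[of i] False by simp
  qed simp
  then have "1 \<le> power_trace \<alpha> A"
    unfolding power_trace_eq[OF U d eq] sum[symmetric] by (intro sum_mono)
  then show ?thesis
    using \<alpha> by (simp add: renyi_entropy_eq)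
qed

text \<open>The contribution p S(\<rho>) of an outcome, expressed through its unnormalised operator.
  At trace zero the leading factor gives the value 0, in agreement with dropping outcomes of
  probability zero.\<close>

definition weighted_renyi :: "real \<Rightarrow> complex^'n^'n \<Rightarrow> real" where
  "weighted_renyi \<alpha> \<omega> = Re (trace \<omega>) * renyi_entropy \<alpha> ((1 / Re (trace \<omega>)) *\<^sub>R \<omega>)"

lemma weighted_renyi_nonneg:
  assumes "psd \<omega>" "0 < \<alpha>" "\<alpha> < 1"
  shows "0 \<le> weighted_renyi \<alpha> \<omega>"
proof (cases "Re (trace \<omega>) = 0")
  case False
  then have "0 \<le> renyi_entropy \<alpha> ((1 / Re (trace \<omega>)) *\<^sub>R \<omega>)"
    using assms psd_trace(2)[OF assms(1)]
    by (intro renyi_entropy_nonneg psd_scaleR) (auto simp: trace_scaleR)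
  then show ?thesis
    using psd_trace(2)[OF assms(1)] by (simp add: weighted_renyi_def)
qed (simp add: weighted_renyi_def)

section \<open>Rank-one operators and superadditivity of the weighted entropy\<close>

lemma trace_ketbra: "trace (ketbra v) = of_real ((norm v)\<^sup>2)"
  unfolding cinner_self[symmetric] by (simp add: trace_def ketbra_def cinner_def mult.commute)

lemma psd_ketbra: "psd (ketbra v)"
proof -
  have "ketbra v *v w = (\<chi> i. cinner v w * v $ i)" for w
    unfolding vec_eq_iff matrix_vector_mult_def ketbra_def cinner_def
    by (simp add: sum_distrib_right) (simp add: mult_ac)
  then have "cinner w (ketbra v *v w) = cinner v w * cinner w v" for w
    by (simp add: cinner_def[of w] sum_distrib_left mult_ac)
  then have "cinner w (ketbra v *v w) = of_real ((cmod (cinner v w))\<^sup>2)" for w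
    using cnj_cinner[of v w] complex_norm_square by metis
  then show ?thesis
    by (simp add: psd_def' del: of_real_power)
qed

lemma psd_sum_list: "(\<And>A. A \<in> set As \<Longrightarrow> psd A) \<Longrightarrow> psd (sum_list As)"
  by (induction As) (auto intro: psd_0 psd_add)

text \<open>Absorb the square roots of the eigenvalues into the eigenvectors. This refines effects
  into rank-one ones and also reduces positivity of the images under linear maps to the case of
  ketbras.\<close>

lemma psd_imp_ketbra_sum:
  assumes "psd A"
  shows "\<exists>vs. A = sum_list (map ketbra vs)"
proof -
  obtain U d where U: "unitary U" and d: "\<And>i. 0 \<le> d i" and A: "A = U ** real_diag d ** adjoint_matrix U"
    using psd_spectral[OF assms] by blast
  define w where "w i = sqrt (d i) *\<^sub>R column i U" for i
  obtain xs :: "'a list" where xs: "set xs = UNIV" "distinct xs"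
    using finite_distinct_list[of "UNIV :: 'a set"] by auto
  have "A $ k $ l = (\<Sum>i\<in>UNIV. ketbra (w i)) $ k $ l" for k l
  proof -
    have "ketbra (w i) $ k $ l = U $ k $ i * of_real (d i) * cnj (U $ l $ i)" for i
    proof -
      have "complex_of_real (d i) = of_real (sqrt (d i)) * of_real (sqrt (d i))"
        using d[of i] by (simp flip: of_real_mult)
      then show ?thesis
        by (simp add: w_def ketbra_def column_def scaleR_conv_of_real[where 'a = complex])
    qed
    then show ?thesis
      by (simp add: A matrix_mult_component[of "U ** real_diag d"] mult_real_diag_component adjoint_component)
  qed
  then have "A = (\<Sum>i\<in>UNIV. ketbra (w i))"
    by (simp add: vec_eq_iff)
  then have "A = sum_list (map ketbra (map w xs))"
    using xs by (simp add: sum_list_distinct_conv_sum_set o_def)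
  then show ?thesis ..
qed

lemma trace_sum_list: "trace (sum_list As) = sum_list (map trace As)"
  for As :: "(complex^'n^'n) list"
  by (induction As) (auto simp: trace_add trace_0[unfolded mat_0])

text \<open>The trace of the sum is the sum of the squared norms, so no summand can be cancelled by
  another.\<close>

lemma ketbra_sum_eq_0:
  assumes "sum_list (map ketbra vs) = 0" "v \<in> set vs"
  shows "v = 0"
proof -
  have "trace (sum_list (map ketbra vs)) = of_real (\<Sum>v\<leftarrow>vs. (norm v)\<^sup>2)"
    unfolding trace_sum_list by (induction vs) (auto simp: trace_ketbra)
  then have "(\<Sum>v\<leftarrow>vs. (norm v)\<^sup>2) = 0"
    using assms(1) by (simp add: trace_def[of 0] del: of_real_power)
  then show ?thesis
    using assms(2) by (subst (asm) sum_list_nonneg_eq_0_iff) auto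
qed

lemma psd_trace_eq_0:
  assumes "psd A" "trace A = 0"
  shows "A = 0"
proof -
  obtain U d where U: "unitary U" and d: "\<And>i. 0 \<le> d i" and A: "A = U ** real_diag d ** adjoint_matrix U"
    using psd_spectral[OF assms(1)] by blast
  have "(\<Sum>i\<in>UNIV. d i) = 0"
    using assms(2) unfolding A trace_unitary_conj[OF U] by (simp only: of_real_eq_0_iff)
  then have "real_diag d = 0"
    using d by (simp add: sum_nonneg_eq_0_iff real_diag_def vec_eq_iff)
  then show ?thesis
    by (simp add: A matrix_matrix_mult_def vec_eq_iff)
qed

text \<open>Concavity turns into superadditivity after rescaling by the traces: the normalised sum
  is a mixture of the normalised summands. A summand of trace zero cannot be normalised, but it is 0
  and contributes nothing.\<close>

lemma weighted_renyi_superadditive: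
  assumes A: "psd A" and B: "psd B" and \<alpha>: "0 < \<alpha>" "\<alpha> < 1"
  shows "weighted_renyi \<alpha> A + weighted_renyi \<alpha> B \<le> weighted_renyi \<alpha> (A + B)"
proof -
  define a b where "a = Re (trace A)" and "b = Re (trace B)"
  have zero: "M = 0" if "psd M" "Re (trace M) = 0" for M :: "complex^'a^'a"
    using that psd_trace_eq_0[of M] psd_trace(1)[of M] by simp
  have wr_0: "weighted_renyi \<alpha> (0 :: complex^'a^'a) = 0"
    by (simp add: weighted_renyi_def trace_def)
  consider "a = 0" | "b = 0" | "0 < a" "0 < b"
    using psd_trace(2)[OF A] psd_trace(2)[OF B] unfolding a_def b_def by linarith
  then show ?thesis
  proof cases
    case 1
    then show ?thesis using zero[OF A] wr_0 by (simp add: a_def)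
  next
    case 2
    then show ?thesis using zero[OF B] wr_0 by (simp add: b_def)
  next
    case 3
    \<comment> \<open>The share of B in the total trace, hence its weight in the mixture.\<close>
    define s where "s = b / (a + b)"
    have s: "0 \<le> s" "s \<le> 1" "1 - s = a / (a + b)"
      using 3 by (auto simp: s_def field_simps)
    have tr: "Re (trace (A + B)) = a + b"
      by (simp add: trace_add a_def b_def)
    have "weighted_renyi \<alpha> A + weighted_renyi \<alpha> B
        = (a + b) * ((1 - s) * renyi_entropy \<alpha> ((1 / a) *\<^sub>R A) + s * renyi_entropy \<alpha> ((1 / b) *\<^sub>R B))"
      unfolding s(3) using 3 by (simp add: s_def weighted_renyi_def distrib_left flip: a_def b_def)
    also have "\<dots> \<le> (a + b) * renyi_entropy \<alpha> ((1 - s) *\<^sub>R ((1 / a) *\<^sub>R A) + s *\<^sub>R ((1 / b) *\<^sub>R B))"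
      using 3 by (intro mult_left_mono renyi_entropy_concave psd_scaleR A B \<alpha> s)
        (auto simp: trace_scaleR a_def[symmetric] b_def[symmetric])
    also have "(1 - s) *\<^sub>R ((1 / a) *\<^sub>R A) + s *\<^sub>R ((1 / b) *\<^sub>R B) = (1 / (a + b)) *\<^sub>R (A + B)"
      unfolding s(3) using 3 by (simp add: s_def scaleR_add_right)
    finally show ?thesis
      by (simp add: weighted_renyi_def tr)
  qed
qed

lemma weighted_renyi_sum_list:
  assumes "\<And>A. A \<in> set As \<Longrightarrow> psd A" and \<alpha>: "0 < \<alpha>" "\<alpha> < 1"
  shows "(\<Sum>A\<leftarrow>As. weighted_renyi \<alpha> A) \<le> weighted_renyi \<alpha> (sum_list As)"
  using assms(1)
proof (induction As)
  case Nil
  then show ?case by (simp add: weighted_renyi_def trace_def)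
next
  case (Cons A As)
  have "weighted_renyi \<alpha> A + weighted_renyi \<alpha> (sum_list As) \<le> weighted_renyi \<alpha> (A + sum_list As)"
    using Cons.prems by (intro weighted_renyi_superadditive psd_sum_list \<alpha>) auto
  with Cons show ?case by force
qed

section \<open>Lifting a decomposition through the matrix of a purification\<close>

lemma matrix_diff_ldistrib: "A ** (B - C) = A ** B - A ** (C :: complex^'n^'m)"
  by (simp add: vec_eq_iff matrix_mult_component sum_subtractf algebra_simps)

lemma matrix_diff_rdistrib: "(A - B) ** C = A ** C - B ** (C :: complex^'n^'m)"
  by (simp add: vec_eq_iff matrix_mult_component sum_subtractf algebra_simps)

lemma matrix_mult_0_left [simp]: "0 ** A = (0 :: complex^'n^'m)"
  by (simp add: vec_eq_iff matrix_mult_component)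

lemma matrix_mult_0_right [simp]: "A ** 0 = (0 :: complex^'n^'m)"
  by (simp add: vec_eq_iff matrix_mult_component)

lemma matrix_add_rdistrib: "(A + B) ** C = A ** C + B ** (C :: complex^'n^'m)"
  by (simp add: vec_eq_iff matrix_mult_component sum.distrib algebra_simps)

lemma conj_sum_list: "B ** sum_list As ** C = (\<Sum>A\<leftarrow>As. B ** A ** C)"
  for B :: "complex^'n^'m"
  by (induction As) (auto simp: matrix_add_ldistrib matrix_add_rdistrib)

lemma ketbra_mult_vec: "B ** ketbra v ** adjoint_matrix B = ketbra (B *v v)"
proof -
  have "(B ** ketbra v ** adjoint_matrix B) $ i $ j = ketbra (B *v v) $ i $ j" for i j
  proof -
    have "(B ** ketbra v) $ i $ k = (B *v v) $ i * cnj (v $ k)" for k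
      by (simp add: matrix_mult_component ketbra_def matrix_vector_mult_def sum_distrib_right mult.assoc)
    moreover have "cnj ((B *v v) $ j) = (\<Sum>k\<in>UNIV. cnj (v $ k) * cnj (B $ j $ k))"
      by (simp add: matrix_vector_mult_def mult.commute)
    ultimately show ?thesis
      by (simp add: matrix_mult_component[of "B ** ketbra v"] adjoint_component sum_distrib_left mult.assoc)
        (simp add: ketbra_def sum_distrib_left)
  qed
  then show ?thesis by (simp add: vec_eq_iff)
qed

lemma psd_conj:
  assumes "psd N"
  shows "psd (B ** N ** adjoint_matrix B)"
proof -
  have "cinner v ((B ** N ** adjoint_matrix B) *v v) = cinner (adjoint_matrix B *v v) (N *v (adjoint_matrix B *v v))" for v
    by (simp add: cinner_adjoint matrix_vector_mul_assoc matrix_mul_assoc)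
  then show ?thesis
    using assms by (simp add: psd_def' adjoint_mult matrix_mul_assoc)
qed

lemma psd_mat_1: "psd (mat 1)"
  by (simp add: psd_def' cinner_self del: of_real_power)

text \<open>The diagonal entries of the product are the squared norms of the columns of B.\<close>

lemma adjoint_mult_self_eq_0:
  assumes "adjoint_matrix B ** B = 0"
  shows "B = 0"
proof -
  have "B $ k $ i = 0" for k i
  proof -
    have "of_real (\<Sum>k\<in>UNIV. (cmod (B $ k $ i))\<^sup>2) = (adjoint_matrix B ** B) $ i $ i"
      by (simp add: matrix_mult_component adjoint_component complex_norm_square[symmetric] mult.commute)
    then have "(\<Sum>k\<in>UNIV. (cmod (B $ k $ i))\<^sup>2) = 0"
      using assms by (simp del: of_real_sum)
    then show ?thesis
      by (simp add: sum_nonneg_eq_0_iff)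
  qed
  then show ?thesis by (simp add: vec_eq_iff)
qed

text \<open>With \<open>K\<close> the pseudo-inverse of \<open>G = \<Psi>\<^sup>\<dagger>\<Psi>\<close>, the matrix \<open>K G\<close> projects onto
  the orthogonal complement of the kernel of \<open>\<Psi>\<close>, and \<open>\<Psi> K \<Psi>\<^sup>\<dagger>\<close> onto the range of \<open>\<Psi>\<close>. The
  vectors \<open>K \<Psi>\<^sup>\<dagger> v\<close> are then the preimages of the \<open>v\<close>, and their ketbras resolve \<open>K G\<close>.\<close>

lemma ketbra_sum_preimage:
  fixes \<Psi> :: "complex^'e^'k"
  assumes vs: "sum_list (map ketbra vs) = \<Psi> ** adjoint_matrix \<Psi>"
  obtains N ms where "psd N" "\<Psi> ** N ** adjoint_matrix \<Psi> = 0"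
    "N + sum_list (map ketbra ms) = mat 1" "map ((*v) \<Psi>) ms = vs"
proof -
  define G where "G = adjoint_matrix \<Psi> ** \<Psi>"
  have G_herm: "adjoint_matrix G = G"
    by (simp add: G_def adjoint_mult)
  obtain U g where U: "unitary U" and G: "G = U ** real_diag g ** adjoint_matrix U"
    using hermitian_spectral[OF G_herm] by blast
  \<comment> \<open>Since \<open>1 / 0 = 0\<close>, taking reciprocals of the eigenvalues gives the
    pseudo-inverse, and g * (1 / g) is 1 or 0 according to whether g vanishes. So P is a projection,
    namely the product of K and G.\<close>
  define K where "K = U ** real_diag (\<lambda>i. 1 / g i) ** adjoint_matrix U"
  define P where "P = U ** real_diag (\<lambda>i. g i * (1 / g i)) ** adjoint_matrix U"
  define Z where "Z = mat 1 - P"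
  have fun_mult: "(U ** real_diag d ** adjoint_matrix U) ** (U ** real_diag e ** adjoint_matrix U)
      = U ** real_diag (\<lambda>i. d i * e i) ** adjoint_matrix U" for d e
  proof -
    have "(U ** real_diag d ** adjoint_matrix U) ** (U ** real_diag e ** adjoint_matrix U)
        = U ** (real_diag d ** real_diag e) ** adjoint_matrix U"
      using U by (simp add: matrix_mul_assoc unitary_cancel)
    then show ?thesis
      by (simp add: real_diag_mult)
  qed
  have herm: "adjoint_matrix K = K" "adjoint_matrix P = P" "adjoint_matrix Z = Z"
    by (simp_all add: K_def P_def Z_def adjoint_mult adjoint_diff matrix_mul_assoc)
  have KG: "K ** G = P" and GK: "G ** K = P" and PP: "P ** P = P" and GP: "G ** P = G"
    unfolding K_def G P_def fun_mult by (auto intro!: arg_cong[where f = "\<lambda>d. U ** real_diag d ** adjoint_matrix U"])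
  \<comment> \<open>\<Psi> vanishes on the range of Z because the Gram matrix of \<Psi> Z is Z G Z,
    and G Z = G - G P = 0.\<close>
  have "adjoint_matrix (\<Psi> ** Z) ** (\<Psi> ** Z) = Z ** (G ** Z)"
    by (simp add: adjoint_mult herm G_def matrix_mul_assoc)
  also have "\<dots> = 0"
    by (simp add: Z_def matrix_diff_ldistrib GP)
  finally have \<Psi>Z: "\<Psi> ** Z = 0"
    by (rule adjoint_mult_self_eq_0)
  then have \<Psi>P: "\<Psi> ** P = \<Psi>"
    by (simp add: Z_def matrix_diff_ldistrib)
  define Q where "Q = \<Psi> ** K ** adjoint_matrix \<Psi>"
  have "Q ** \<Psi> = \<Psi>"
    by (metis G_def KG Q_def \<Psi>P matrix_mul_assoc)
  then have R\<Psi>: "(mat 1 - Q) ** \<Psi> = 0"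
    by (simp add: matrix_diff_rdistrib)
  \<comment> \<open>Each v lies in the range of \<Psi>: as 1 - Q annihilates \<Psi>, it annihilates
    the whole sum of ketbras, hence every vector in it.\<close>
  have "sum_list (map ketbra (map ((*v) (mat 1 - Q)) vs))
      = (mat 1 - Q) ** sum_list (map ketbra vs) ** adjoint_matrix (mat 1 - Q)"
    by (simp add: conj_sum_list ketbra_mult_vec o_def)
  also have "\<dots> = 0"
    by (simp add: vs R\<Psi> matrix_mul_assoc)
  finally have "(mat 1 - Q) *v v = 0" if "v \<in> set vs" for v
    by (rule ketbra_sum_eq_0) (use that in auto)
  then have Q: "Q *v v = v" if "v \<in> set vs" for v
    using that by (simp add: matrix_vector_mult_diff_rdistrib)
  define ms where "ms = map ((*v) (K ** adjoint_matrix \<Psi>)) vs"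
  have "map ((*v) \<Psi>) ms = map ((*v) Q) vs"
    by (simp add: ms_def Q_def matrix_vector_mul_assoc matrix_mul_assoc)
  also have "\<dots> = vs"
    using Q by (intro map_idI)
  finally have ms: "map ((*v) \<Psi>) ms = vs" .
  have "sum_list (map ketbra ms)
      = (K ** adjoint_matrix \<Psi>) ** sum_list (map ketbra vs) ** adjoint_matrix (K ** adjoint_matrix \<Psi>)"
    by (simp add: conj_sum_list ketbra_mult_vec ms_def o_def)
  also have "\<dots> = (K ** G) ** (G ** K)"
    by (simp add: vs G_def adjoint_mult herm matrix_mul_assoc)
  finally have "sum_list (map ketbra ms) = P"
    by (simp add: KG GK PP)
  then have "Z + sum_list (map ketbra ms) = mat 1"
    by (simp add: Z_def)
  \<comment> \<open>Z is a Hermitian projection, so it is positive and can serve as the completing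
    effect N.\<close>
  moreover have "Z ** mat 1 ** adjoint_matrix Z = Z"
    unfolding herm by (simp add: Z_def matrix_diff_ldistrib matrix_diff_rdistrib PP)
  then have "psd Z"
    using psd_conj[OF psd_mat_1, of Z] by simp
  ultimately show thesis
    using that \<Psi>Z ms by simp
qed

section \<open>Partial traces and transposes\<close>

lemma psd_sum: "finite S \<Longrightarrow> (\<And>i. i \<in> S \<Longrightarrow> psd (f i)) \<Longrightarrow> psd (\<Sum>i\<in>S. f i)"
  by (induction S rule: finite_induct) (auto intro: psd_0 psd_add)

lemma ptrace_snd_add: "ptrace_snd (A + B) = ptrace_snd A + ptrace_snd B"
  by (simp add: ptrace_snd_def vec_eq_iff sum.distrib)

lemma ptrace_snd_0 [simp]: "ptrace_snd 0 = 0"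
  by (simp add: ptrace_snd_def vec_eq_iff)

lemma ptrace_snd_scaleR: "ptrace_snd (c *\<^sub>R A) = c *\<^sub>R ptrace_snd A"
  by (simp add: ptrace_snd_def vec_eq_iff scaleR_sum_right)

lemma ptrace_snd_sum_list: "ptrace_snd (sum_list As) = (\<Sum>A\<leftarrow>As. ptrace_snd A)"
  by (induction As) (auto simp: ptrace_snd_add)

lemma trace_ptrace_snd: "trace (ptrace_snd R) = trace R"
proof -
  have "trace (ptrace_snd R) = (\<Sum>x\<in>UNIV \<times> UNIV. R $ x $ x)"
    by (simp add: trace_def ptrace_snd_def sum.cartesian_product split_def)
  then show ?thesis
    by (simp add: trace_def)
qed

text \<open>By linearity it suffices to treat a ketbra, whose partial trace is the sum of the
  ketbras of the slices of v with the second index fixed.\<close>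

lemma psd_ptrace_snd:
  assumes "psd (R :: complex^('a::finite \<times> 'b::finite)^('a \<times> 'b))"
  shows "psd (ptrace_snd R)"
proof -
  obtain vs where R: "R = sum_list (map ketbra vs)"
    using psd_imp_ketbra_sum[OF assms] by blast
  have "psd (ptrace_snd (ketbra v))" for v :: "complex^('a \<times> 'b)"
  proof -
    have "ptrace_snd (ketbra v) = (\<Sum>b\<in>UNIV. ketbra (\<chi> a. v $ (a, b)))"
      by (simp add: ptrace_snd_def ketbra_def vec_eq_iff)
    then show ?thesis
      by (simp add: psd_sum psd_ketbra)
  qed
  then show ?thesis
    unfolding R ptrace_snd_sum_list by (intro psd_sum_list) auto
qed

lemma transpose_add: "transpose (A + B) = transpose A + transpose B"
  by (simp add: transpose_def vec_eq_iff)

lemma transpose_0 [simp]: "transpose 0 = 0"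
  by (simp add: transpose_def vec_eq_iff)

lemma transpose_sum_list: "transpose (sum_list As) = (\<Sum>A\<leftarrow>As. transpose A)"
  by (induction As) (auto simp: transpose_add)

text \<open>Transposing a ketbra conjugates the entries of its vector, so a sum of ketbras stays
  one.\<close>

lemma psd_transpose:
  assumes "psd A"
  shows "psd (transpose A)"
proof -
  obtain vs where A: "A = sum_list (map ketbra vs)"
    using psd_imp_ketbra_sum[OF assms] by blast
  have "transpose (ketbra v) = ketbra (\<chi> i. cnj (v $ i))" for v :: "complex^'a"
    by (simp add: transpose_def ketbra_def vec_eq_iff mult.commute)
  then show ?thesis
    unfolding A transpose_sum_list by (intro psd_sum_list) (auto simp: psd_ketbra)
qed

section \<open>Pure-state ensembles as lists of unnormalised vectors\<close>

lemma ketbra_scaleR: "ketbra (c *\<^sub>R v) = c\<^sup>2 *\<^sub>R ketbra v"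
  by (simp add: ketbra_def vec_eq_iff power2_eq_square)

lemma ketbra_0 [simp]: "ketbra 0 = 0"
  by (simp add: ketbra_def vec_eq_iff)

lemma weighted_renyi_0 [simp]: "weighted_renyi \<alpha> 0 = 0"
  by (simp add: weighted_renyi_def trace_def)

text \<open>With c the square root of a probability, the weight is stored in the length of the
  vector, so a weighted pure ensemble becomes a plain list of vectors.\<close>

lemma weighted_renyi_ketbra:
  assumes "0 \<le> c" "norm v = 1"
  shows "weighted_renyi \<alpha> (ptrace_snd (ketbra (c *\<^sub>R v))) = c\<^sup>2 * renyi_entropy \<alpha> (ptrace_snd (ketbra v))"
proof (cases "c = 0")
  case False
  have "trace (ptrace_snd (ketbra (c *\<^sub>R v))) = of_real (c\<^sup>2)"
    using assms by (simp add: trace_ptrace_snd trace_ketbra)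
  then have "weighted_renyi \<alpha> (ptrace_snd (ketbra (c *\<^sub>R v)))
      = c\<^sup>2 * renyi_entropy \<alpha> ((1 / c\<^sup>2) *\<^sub>R ptrace_snd (ketbra (c *\<^sub>R v)))"
    unfolding weighted_renyi_def by (simp del: of_real_power)
  then show ?thesis
    using False by (simp add: ketbra_scaleR ptrace_snd_scaleR)
qed (simp add: ketbra_scaleR)

lemma weighted_renyi_ketbra_normalized:
  assumes "v \<noteq> 0"
  shows "weighted_renyi \<alpha> (ptrace_snd (ketbra v))
    = (norm v)\<^sup>2 * renyi_entropy \<alpha> (ptrace_snd (ketbra ((1 / norm v) *\<^sub>R v)))"
  using weighted_renyi_ketbra[of "norm v" "(1 / norm v) *\<^sub>R v" \<alpha>] assms by simp

text \<open>Normalise each vector and use its squared norm as probability. Zero vectors have no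
  direction and contribute nothing to either sum, so they are filtered out; unit trace makes the
  probabilities sum to 1.\<close>

lemma pure_decomposition_of_vectors:
  fixes vs :: "(complex^('a::finite \<times> 'b::finite)) list"
  assumes \<rho>: "\<rho> = sum_list (map ketbra vs)" and tr: "trace \<rho> = 1"
  obtains ds where "pure_decomposition \<rho> ds"
    "(\<Sum>(p, \<phi>)\<leftarrow>ds. p * renyi_entropy \<alpha> (ptrace_snd (ketbra \<phi>)))
      = (\<Sum>v\<leftarrow>vs. weighted_renyi \<alpha> (ptrace_snd (ketbra v)))"
proof
  define ds where "ds = map (\<lambda>v. ((norm v)\<^sup>2, (1 / norm v) *\<^sub>R v)) (filter (\<lambda>v. v \<noteq> 0) vs)"
  have "(\<Sum>(p, \<phi>)\<leftarrow>ds. p *\<^sub>R ketbra \<phi>) = \<rho>"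
    unfolding \<rho> ds_def by (induction vs) (auto simp: ketbra_scaleR power_divide)
  moreover have "complex_of_real (\<Sum>(p, \<phi>)\<leftarrow>ds. p) = trace \<rho>"
    unfolding \<rho> ds_def trace_sum_list by (induction vs) (auto simp: trace_ketbra)
  then have "(\<Sum>(p, \<phi>)\<leftarrow>ds. p) = 1"
    unfolding tr of_real_eq_1_iff .
  moreover have "\<forall>(p, \<phi>)\<in>set ds. 0 \<le> p \<and> norm \<phi> = 1"
    by (auto simp: ds_def)
  ultimately show "pure_decomposition \<rho> ds"
    by (simp add: pure_decomposition_def)
  show "(\<Sum>(p, \<phi>)\<leftarrow>ds. p * renyi_entropy \<alpha> (ptrace_snd (ketbra \<phi>)))
      = (\<Sum>v\<leftarrow>vs. weighted_renyi \<alpha> (ptrace_snd (ketbra v)))"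
    unfolding ds_def by (induction vs) (auto simp: weighted_renyi_ketbra_normalized)
qed

lemma vectors_of_pure_decomposition:
  assumes "pure_decomposition \<rho> ds"
  obtains vs where "sum_list (map ketbra vs) = \<rho>"
    "(\<Sum>v\<leftarrow>vs. weighted_renyi \<alpha> (ptrace_snd (ketbra v)))
      = (\<Sum>(p, \<phi>)\<leftarrow>ds. p * renyi_entropy \<alpha> (ptrace_snd (ketbra \<phi>)))"
proof
  define vs where "vs = map (\<lambda>(p, \<phi>). sqrt p *\<^sub>R \<phi>) ds"
  have ds: "\<forall>(p, \<phi>)\<in>set ds. 0 \<le> p \<and> norm \<phi> = 1" and \<rho>: "\<rho> = (\<Sum>(p, \<phi>)\<leftarrow>ds. p *\<^sub>R ketbra \<phi>)"
    using assms by (auto simp: pure_decomposition_def)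
  show "sum_list (map ketbra vs) = \<rho>"
    unfolding \<rho> vs_def using ds by (induction ds) (auto simp: ketbra_scaleR)
  show "(\<Sum>v\<leftarrow>vs. weighted_renyi \<alpha> (ptrace_snd (ketbra v)))
      = (\<Sum>(p, \<phi>)\<leftarrow>ds. p * renyi_entropy \<alpha> (ptrace_snd (ketbra \<phi>)))"
    unfolding vs_def using ds by (induction ds) (auto simp: weighted_renyi_ketbra)
qed

text \<open>A positive operator of trace zero is 0, so the filter changes neither the average nor
  the weighted entropies, and normalisation cancels against the probabilities.\<close>

lemma jensen_shannon_normalized:
  assumes "\<And>\<omega>. \<omega> \<in> set ws \<Longrightarrow> psd \<omega>"
  shows "jensen_shannon \<alpha> (map (\<lambda>\<omega>. (Re (trace \<omega>), (1 / Re (trace \<omega>)) *\<^sub>R \<omega>)) (filter (\<lambda>\<omega>. trace \<omega> \<noteq> 0) ws))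
    = renyi_entropy \<alpha> (sum_list ws) - (\<Sum>\<omega>\<leftarrow>ws. weighted_renyi \<alpha> \<omega>)"
    (is "jensen_shannon \<alpha> (?\<xi> ws) = _")
proof -
  have zero: "\<omega> = 0" if "\<omega> \<in> set ws" "trace \<omega> = 0" for \<omega>
    using that assms psd_trace_eq_0 by blast
  have nonzero: "Re (trace \<omega>) \<noteq> 0" if "\<omega> \<in> set ws" "trace \<omega> \<noteq> 0" for \<omega>
    using that assms psd_trace(1)[of \<omega>] by fastforce
  have "(\<Sum>(p, \<rho>)\<leftarrow>?\<xi> ws. p *\<^sub>R \<rho>) = sum_list ws"
    using zero nonzero by (induction ws) auto
  moreover have "(\<Sum>(p, \<rho>)\<leftarrow>?\<xi> ws. p * renyi_entropy \<alpha> \<rho>) = (\<Sum>\<omega>\<leftarrow>ws. weighted_renyi \<alpha> \<omega>)"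
    using zero nonzero by (induction ws) (auto simp: weighted_renyi_def)
  ultimately show ?thesis
    by (simp add: jensen_shannon_def)
qed

section \<open>Measurements on the purifying system\<close>

definition purification_matrix :: "complex^('a::finite \<times> 'b::finite \<times> 'e::finite) \<Rightarrow> complex^'e^('a \<times> 'b)" where
  "purification_matrix \<psi> = (\<chi> x e. \<psi> $ (fst x, snd x, e))"

lemma ptrace_E_ketbra:
  "ptrace_E (ketbra \<psi>) = purification_matrix \<psi> ** adjoint_matrix (purification_matrix \<psi>)"
  by (simp add: ptrace_E_def ketbra_def purification_matrix_def vec_eq_iff matrix_mult_component
      adjoint_component)

lemma ptrace_snd_ketbra_purification:
  "ptrace_snd (ketbra \<psi>) = ptrace_snd (purification_matrix \<psi> ** adjoint_matrix (purification_matrix \<psi>))"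
proof -
  have "(\<Sum>k\<in>UNIV. f k) = (\<Sum>b\<in>UNIV. \<Sum>e\<in>UNIV. f (b, e))" for f :: "'b \<times> 'c \<Rightarrow> complex"
    by (simp add: sum.cartesian_product flip: UNIV_Times_UNIV)
  then show ?thesis
    by (simp add: ptrace_snd_def ketbra_def purification_matrix_def vec_eq_iff matrix_mult_component
        adjoint_component)
qed

text \<open>The transpose appears because \<open>\<Psi>\<close> identifies \<open>E\<close> with its dual.\<close>

lemma post_measurement_operator:
  fixes \<psi> :: "complex^('a::finite \<times> 'b::finite \<times> 'e::finite)"
  shows "ptrace_snd (tensor (mat 1) M ** ptrace_B (ketbra \<psi>))
    = ptrace_snd (purification_matrix \<psi> ** transpose M ** adjoint_matrix (purification_matrix \<psi>))"
proof -
  have pair: "(\<Sum>k\<in>UNIV. f k) = (\<Sum>a\<in>UNIV. \<Sum>e\<in>UNIV. f (a, e))" for f :: "'a \<times> 'e \<Rightarrow> complex"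
    by (simp add: sum.cartesian_product flip: UNIV_Times_UNIV)
  have "ptrace_snd (tensor (mat 1) M ** ptrace_B (ketbra \<psi>)) $ i $ j
      = ptrace_snd (purification_matrix \<psi> ** transpose M ** adjoint_matrix (purification_matrix \<psi>)) $ i $ j" for i j
  proof -
    \<comment> \<open>The identity on A contributes a Kronecker delta between a and i. Moving the
      sum over a innermost lets it collapse.\<close>
    have "ptrace_snd (tensor (mat 1) M ** ptrace_B (ketbra \<psi>)) $ i $ j
        = (\<Sum>k\<in>UNIV. \<Sum>e\<in>UNIV. \<Sum>a\<in>UNIV. if a = i then M $ k $ e * (\<Sum>b\<in>UNIV. \<psi> $ (a, b, e) * cnj (\<psi> $ (j, b, k))) else 0)"
      by (subst sum.swap)
        (auto simp: ptrace_snd_def matrix_mult_component pair tensor_def mat_def ptrace_B_def ketbra_def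
          intro!: sum.cong)
    also have "\<dots> = (\<Sum>k\<in>UNIV. \<Sum>e\<in>UNIV. \<Sum>b\<in>UNIV. M $ k $ e * (\<psi> $ (i, b, e) * cnj (\<psi> $ (j, b, k))))"
      by (simp add: sum_distrib_left)
    also have "\<dots> = (\<Sum>k\<in>UNIV. \<Sum>b\<in>UNIV. \<Sum>e\<in>UNIV. M $ k $ e * (\<psi> $ (i, b, e) * cnj (\<psi> $ (j, b, k))))"
      by (intro sum.cong refl sum.swap)
    also have "\<dots> = (\<Sum>b\<in>UNIV. \<Sum>k\<in>UNIV. \<Sum>e\<in>UNIV. M $ k $ e * (\<psi> $ (i, b, e) * cnj (\<psi> $ (j, b, k))))"
      by (rule sum.swap)
    also have "\<dots> = ptrace_snd (purification_matrix \<psi> ** transpose M ** adjoint_matrix (purification_matrix \<psi>)) $ i $ j"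
      by (simp add: ptrace_snd_def purification_matrix_def matrix_mult_component adjoint_component
          transpose_def sum_distrib_left mult_ac)
    finally show ?thesis .
  qed
  then show ?thesis by (simp add: vec_eq_iff)
qed

text \<open>The argument N stands for the transposed effect. In this form the ketbra of v yields the
  reduction to A of the pure operator of \<Psi> v.\<close>

definition post_measurement ::
  "complex^('a::finite \<times> 'b::finite \<times> 'e::finite) \<Rightarrow> complex^'e^'e \<Rightarrow> complex^'a^'a" where
  "post_measurement \<psi> N = ptrace_snd (purification_matrix \<psi> ** N ** adjoint_matrix (purification_matrix \<psi>))"

lemma post_measurement_sum_list:
  "post_measurement \<psi> (sum_list Ns) = (\<Sum>N\<leftarrow>Ns. post_measurement \<psi> N)"
  by (simp add: post_measurement_def conj_sum_list ptrace_snd_sum_list o_def)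

lemma psd_post_measurement: "psd N \<Longrightarrow> psd (post_measurement \<psi> N)"
  unfolding post_measurement_def by (intro psd_ptrace_snd psd_conj)

lemma post_measurement_ketbra:
  "post_measurement \<psi> (ketbra v) = ptrace_snd (ketbra (purification_matrix \<psi> *v v))"
  by (simp add: post_measurement_def ketbra_mult_vec)

lemma post_measurement_mat_1: "post_measurement \<psi> (mat 1) = ptrace_snd (ketbra \<psi>)"
  by (simp add: post_measurement_def ptrace_snd_ketbra_purification)

text \<open>The effects sum to the identity, so the average of the created ensemble is the reduced
  state on A for every POVM; only the subtracted sum depends on the measurement.\<close>

lemma jensen_shannon_created_ensemble:
  assumes "povm Ms"
  shows "jensen_shannon \<alpha> (created_ensemble (ptrace_B (ketbra \<psi>)) Ms)
    = renyi_entropy \<alpha> (ptrace_snd (ketbra \<psi>))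
      - (\<Sum>M\<leftarrow>Ms. weighted_renyi \<alpha> (post_measurement \<psi> (transpose M)))"
proof -
  define ws where "ws = map (\<lambda>M. post_measurement \<psi> (transpose M)) Ms"
  have "psd \<omega>" if "\<omega> \<in> set ws" for \<omega>
    using that assms by (auto simp: ws_def povm_def intro: psd_post_measurement psd_transpose)
  then have "jensen_shannon \<alpha> (map (\<lambda>\<omega>. (Re (trace \<omega>), (1 / Re (trace \<omega>)) *\<^sub>R \<omega>)) (filter (\<lambda>\<omega>. trace \<omega> \<noteq> 0) ws))
    = renyi_entropy \<alpha> (sum_list ws) - (\<Sum>\<omega>\<leftarrow>ws. weighted_renyi \<alpha> \<omega>)"
    by (rule jensen_shannon_normalized)
  moreover have "sum_list ws = post_measurement \<psi> (transpose (sum_list Ms))"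
    by (simp add: ws_def transpose_sum_list post_measurement_sum_list o_def)
  then have "sum_list ws = ptrace_snd (ketbra \<psi>)"
    using assms by (simp add: povm_def transpose_mat post_measurement_mat_1)
  ultimately show ?thesis
    by (simp add: created_ensemble_def post_measurement_operator ws_def o_def flip: post_measurement_def)
qed

section \<open>Passing between POVMs and pure-state decompositions\<close>

text \<open>Yields the upper bound on the supremum. The transposed effects are split into ketbras,
  whose vectors \<Psi> sends to a decomposition of the state on A \<otimes> B because the effects
  sum to the identity.\<close>

lemma pure_decomposition_refining_povm:
  assumes "norm \<psi> = 1" "povm Ms" and \<alpha>: "0 < \<alpha>" "\<alpha> < 1"
  obtains ds where "pure_decomposition (ptrace_E (ketbra \<psi>)) ds"
    "(\<Sum>(p, \<phi>)\<leftarrow>ds. p * renyi_entropy \<alpha> (ptrace_snd (ketbra \<phi>)))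
      \<le> (\<Sum>M\<leftarrow>Ms. weighted_renyi \<alpha> (post_measurement \<psi> (transpose M)))"
proof -
  define \<Psi> where "\<Psi> = purification_matrix \<psi>"
  have "\<forall>M\<in>set Ms. \<exists>vs. transpose M = sum_list (map ketbra vs)"
    using assms(2) by (auto simp: povm_def intro: psd_imp_ketbra_sum psd_transpose)
  then obtain f where f: "\<And>M. M \<in> set Ms \<Longrightarrow> transpose M = sum_list (map ketbra (f M))"
    by metis
  define vs where "vs = concat (map (\<lambda>M. map ((*v) \<Psi>) (f M)) Ms)"
  have "sum_list (map ketbra vs) = \<Psi> ** (\<Sum>M\<leftarrow>Ms. transpose M) ** adjoint_matrix \<Psi>"
    unfolding vs_def using f
    by (induction Ms) (auto simp: conj_sum_list ketbra_mult_vec matrix_add_ldistrib matrix_add_rdistrib o_def)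
  also have "(\<Sum>M\<leftarrow>Ms. transpose M) = mat 1"
    using assms(2) by (simp add: povm_def transpose_mat flip: transpose_sum_list)
  finally have "ptrace_E (ketbra \<psi>) = sum_list (map ketbra vs)"
    by (simp add: ptrace_E_ketbra \<Psi>_def)
  moreover have "trace (ptrace_E (ketbra \<psi>)) = 1"
  proof -
    have "trace (ptrace_E (ketbra \<psi>)) = trace (ptrace_snd (ketbra \<psi>))"
      by (simp add: ptrace_E_ketbra ptrace_snd_ketbra_purification trace_ptrace_snd)
    then show ?thesis
      using assms(1) by (simp add: trace_ptrace_snd trace_ketbra)
  qed
  ultimately obtain ds where ds: "pure_decomposition (ptrace_E (ketbra \<psi>)) ds"
    "(\<Sum>(p, \<phi>)\<leftarrow>ds. p * renyi_entropy \<alpha> (ptrace_snd (ketbra \<phi>)))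
      = (\<Sum>v\<leftarrow>vs. weighted_renyi \<alpha> (ptrace_snd (ketbra v)))"
    using pure_decomposition_of_vectors[of "ptrace_E (ketbra \<psi>)" vs \<alpha>] by metis
  \<comment> \<open>Superadditivity, applied separately to the rank-one pieces of each
    effect.\<close>
  have le: "(\<Sum>v\<leftarrow>f M. weighted_renyi \<alpha> (ptrace_snd (ketbra (\<Psi> *v v))))
      \<le> weighted_renyi \<alpha> (post_measurement \<psi> (transpose M))" if "M \<in> set Ms" for M
  proof -
    have "(\<Sum>A\<leftarrow>map (\<lambda>v. post_measurement \<psi> (ketbra v)) (f M). weighted_renyi \<alpha> A)
        \<le> weighted_renyi \<alpha> (\<Sum>v\<leftarrow>f M. post_measurement \<psi> (ketbra v))"
      by (intro weighted_renyi_sum_list \<alpha>) (auto simp: psd_post_measurement psd_ketbra)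
    then show ?thesis
      by (simp add: f[OF that] post_measurement_sum_list o_def post_measurement_ketbra \<Psi>_def)
  qed
  have "(\<Sum>v\<leftarrow>vs. weighted_renyi \<alpha> (ptrace_snd (ketbra v)))
      \<le> (\<Sum>M\<leftarrow>Ms. weighted_renyi \<alpha> (post_measurement \<psi> (transpose M)))"
    unfolding vs_def using le by (induction Ms) (auto simp: o_def add_mono)
  with ds show thesis
    using that by simp
qed

text \<open>Yields the lower bound on the supremum: the value of each decomposition is matched
  exactly, so no limiting argument is needed.\<close>

lemma povm_of_pure_decomposition:
  assumes "pure_decomposition (ptrace_E (ketbra \<psi>)) ds"
  obtains Ms where "povm Ms"
    "(\<Sum>M\<leftarrow>Ms. weighted_renyi \<alpha> (post_measurement \<psi> (transpose M)))
      = (\<Sum>(p, \<phi>)\<leftarrow>ds. p * renyi_entropy \<alpha> (ptrace_snd (ketbra \<phi>)))"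
proof -
  define \<Psi> where "\<Psi> = purification_matrix \<psi>"
  obtain vs where vs: "sum_list (map ketbra vs) = \<Psi> ** adjoint_matrix \<Psi>"
    and val: "(\<Sum>v\<leftarrow>vs. weighted_renyi \<alpha> (ptrace_snd (ketbra v)))
      = (\<Sum>(p, \<phi>)\<leftarrow>ds. p * renyi_entropy \<alpha> (ptrace_snd (ketbra \<phi>)))"
    using vectors_of_pure_decomposition[OF assms, of \<alpha>] by (auto simp: ptrace_E_ketbra \<Psi>_def)
  obtain N ms where N: "psd N" "\<Psi> ** N ** adjoint_matrix \<Psi> = 0"
    and sum: "N + sum_list (map ketbra ms) = mat 1" and ms: "map ((*v) \<Psi>) ms = vs"
    using ketbra_sum_preimage[OF vs] by metis
  \<comment> \<open>Transposed in advance, to cancel the transposition that the measurement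
    introduces.\<close>
  define Ms where "Ms = map transpose (N # map ketbra ms)"
  have "povm Ms"
    using N(1) sum unfolding Ms_def povm_def transpose_sum_list[symmetric]
    by (auto simp: psd_transpose psd_ketbra transpose_mat)
  moreover have "(\<Sum>M\<leftarrow>Ms. weighted_renyi \<alpha> (post_measurement \<psi> (transpose M)))
      = (\<Sum>v\<leftarrow>vs. weighted_renyi \<alpha> (ptrace_snd (ketbra v)))"
  proof -
    \<comment> \<open>The completing effect is an outcome of probability zero, so its weighted
      entropy is 0.\<close>
    have "post_measurement \<psi> N = 0"
      using N(2) by (simp add: post_measurement_def \<Psi>_def)
    then show ?thesis
      unfolding ms[symmetric] by (simp add: Ms_def o_def post_measurement_ketbra \<Psi>_def)
  qed
  ultimately show thesis
    using that val by simp
qed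

theorem theorem13:
  fixes \<alpha> :: real
    and \<psi> :: "complex^('a::finite \<times> 'b::finite \<times> 'e::finite)"
    and \<rho>\<^sub>A\<^sub>B\<^sub>E :: "complex^('a \<times> 'b \<times> 'e)^('a \<times> 'b \<times> 'e)"
    and \<rho>\<^sub>A\<^sub>E :: "complex^('a \<times> 'e)^('a \<times> 'e)"
    and \<rho>\<^sub>A\<^sub>B :: "complex^('a \<times> 'b)^('a \<times> 'b)"
    and \<rho>\<^sub>A :: "complex^'a^'a"
  assumes "0 < \<alpha>" and "\<alpha> < 1"
    and "norm \<psi> = 1"
    and "\<rho>\<^sub>A\<^sub>B\<^sub>E = ketbra \<psi>"
    and "\<rho>\<^sub>A\<^sub>E = ptrace_B \<rho>\<^sub>A\<^sub>B\<^sub>E"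
    and "\<rho>\<^sub>A\<^sub>B = ptrace_E \<rho>\<^sub>A\<^sub>B\<^sub>E"
    and "\<rho>\<^sub>A = ptrace_snd \<rho>\<^sub>A\<^sub>B\<^sub>E"
  shows "C_alpha \<alpha> \<rho>\<^sub>A\<^sub>E = (SUP \<xi>\<in>{created_ensemble \<rho>\<^sub>A\<^sub>E Ms |Ms. povm Ms}. jensen_shannon \<alpha> \<xi>)
    \<and> (SUP \<xi>\<in>{created_ensemble \<rho>\<^sub>A\<^sub>E Ms |Ms. povm Ms}. jensen_shannon \<alpha> \<xi>)
        = renyi_entropy \<alpha> \<rho>\<^sub>A - E_formation \<alpha> \<rho>\<^sub>A\<^sub>B"
proof -
  define J where "J Ms = jensen_shannon \<alpha> (created_ensemble \<rho>\<^sub>A\<^sub>E Ms)" for Ms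
  define val where "val ds = (\<Sum>(p, \<phi>)\<leftarrow>ds. p * renyi_entropy \<alpha> (ptrace_snd (ketbra \<phi>)))"
    for ds :: "(real \<times> (complex^('a \<times> 'b))) list"
  have J_eq: "J Ms = renyi_entropy \<alpha> \<rho>\<^sub>A - (\<Sum>M\<leftarrow>Ms. weighted_renyi \<alpha> (post_measurement \<psi> (transpose M)))"
    if "povm Ms" for Ms
    unfolding J_def assms(4,5,7) by (rule jensen_shannon_created_ensemble[OF that])
  have image: "{created_ensemble \<rho>\<^sub>A\<^sub>E Ms |Ms. povm Ms} = created_ensemble \<rho>\<^sub>A\<^sub>E ` {Ms. povm Ms}"
    by auto
  have C_eq: "C_alpha \<alpha> \<rho>\<^sub>A\<^sub>E = (SUP Ms\<in>{Ms. povm Ms}. J Ms)"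
    "(SUP \<xi>\<in>{created_ensemble \<rho>\<^sub>A\<^sub>E Ms |Ms. povm Ms}. jensen_shannon \<alpha> \<xi>) = (SUP Ms\<in>{Ms. povm Ms}. J Ms)"
    by (simp_all add: C_alpha_def J_def image image_image)
  \<comment> \<open>The trivial measurement makes the set of POVMs nonempty and, through
    \<open>refine\<close>, the set of pure decompositions as well.\<close>
  have povm_1: "povm [mat 1 :: complex^'e^'e]"
    by (simp add: povm_def psd_mat_1)
  \<comment> \<open>Nonnegative entropies bound the supremum from above and, below, the infimum by
    0, as the conditionally complete order of the reals demands.\<close>
  have "J Ms \<le> renyi_entropy \<alpha> \<rho>\<^sub>A" if "povm Ms" for Ms
    using that assms(1,2) unfolding J_eq[OF that]
    by (auto simp: povm_def intro!: sum_list_nonneg weighted_renyi_nonneg psd_post_measurement psd_transpose)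
  then have bdd_J: "bdd_above (J ` {Ms. povm Ms})"
    by (intro bdd_aboveI2) auto
  have "0 \<le> val ds" if "pure_decomposition \<rho>\<^sub>A\<^sub>B ds" for ds
    using that assms(1,2) unfolding val_def pure_decomposition_def
    by (fastforce intro!: sum_list_nonneg mult_nonneg_nonneg renyi_entropy_nonneg psd_ptrace_snd psd_ketbra
        simp: trace_ptrace_snd trace_ketbra)
  then have bdd_val: "bdd_below (val ` {ds. pure_decomposition \<rho>\<^sub>A\<^sub>B ds})"
    by (intro bdd_belowI2) auto
  have E: "E_formation \<alpha> \<rho>\<^sub>A\<^sub>B = (INF ds\<in>{ds. pure_decomposition \<rho>\<^sub>A\<^sub>B ds}. val ds)"
    by (simp add: E_formation_def val_def)
  have refine: "\<exists>ds. pure_decomposition \<rho>\<^sub>A\<^sub>B ds \<and> J Ms \<le> renyi_entropy \<alpha> \<rho>\<^sub>A - val ds" if "povm Ms" for Ms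
    using pure_decomposition_refining_povm[OF assms(3) that assms(1,2)]
    unfolding J_eq[OF that] val_def assms(4,6) by (metis diff_left_mono)
  have realise: "\<exists>Ms. povm Ms \<and> J Ms = renyi_entropy \<alpha> \<rho>\<^sub>A - val ds" if "pure_decomposition \<rho>\<^sub>A\<^sub>B ds" for ds
    using povm_of_pure_decomposition[of \<psi> ds \<alpha>] that
    unfolding val_def assms(4,6) by (metis J_eq)
  have "(SUP Ms\<in>{Ms. povm Ms}. J Ms) \<le> renyi_entropy \<alpha> \<rho>\<^sub>A - E_formation \<alpha> \<rho>\<^sub>A\<^sub>B"
  proof (rule cSUP_least)
    fix Ms :: "(complex^'e^'e) list"
    assume "Ms \<in> {Ms. povm Ms}"
    then obtain ds where ds: "pure_decomposition \<rho>\<^sub>A\<^sub>B ds" "J Ms \<le> renyi_entropy \<alpha> \<rho>\<^sub>A - val ds"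
      using refine by auto
    moreover have "E_formation \<alpha> \<rho>\<^sub>A\<^sub>B \<le> val ds"
      unfolding E using ds(1) by (intro cINF_lower bdd_val) auto
    ultimately show "J Ms \<le> renyi_entropy \<alpha> \<rho>\<^sub>A - E_formation \<alpha> \<rho>\<^sub>A\<^sub>B"
      by simp
  qed (use povm_1 in auto)
  \<comment> \<open>Rearranged so that the infimum stands alone on the right and every single
    decomposition can be tested against the lower bound.\<close>
  moreover have "renyi_entropy \<alpha> \<rho>\<^sub>A - (SUP Ms\<in>{Ms. povm Ms}. J Ms) \<le> E_formation \<alpha> \<rho>\<^sub>A\<^sub>B"
    unfolding E
  proof (rule cINF_greatest)
    show "{ds. pure_decomposition \<rho>\<^sub>A\<^sub>B ds} \<noteq> {}"
      using refine[OF povm_1] by auto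
    fix ds
    assume "ds \<in> {ds. pure_decomposition \<rho>\<^sub>A\<^sub>B ds}"
    then obtain Ms where Ms: "povm Ms" "J Ms = renyi_entropy \<alpha> \<rho>\<^sub>A - val ds"
      using realise by auto
    have "J Ms \<le> (SUP Ms\<in>{Ms. povm Ms}. J Ms)"
      using Ms(1) by (intro cSUP_upper bdd_J) auto
    then show "renyi_entropy \<alpha> \<rho>\<^sub>A - (SUP Ms\<in>{Ms. povm Ms}. J Ms) \<le> val ds"
      using Ms(2) by simp
  qed
  ultimately show ?thesis
    unfolding C_eq by simp
qed

end
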